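(* Let $\Gamma$ be a finite set of RGA terms and $c$ an RGA term such that $\Gamma\vdash c$ is derivable. Then for every assignment $A$: if every hypothesis in $\Gamma$ is grounded true under $A$, then $c$ is grounded true under $A$.
   Context: **Terms.** Raw terms are: variables $v_i$ ($i\in\mathbb N$, de Bruijn indices), and operator nodes, each consisting of an operator code, a binder count $k\in\mathbb N$ and a finite list of raw terms as arguments, in each of which the $k$ lowest indices are bound. RGA has ten operators: constants $\bot$, $\mathbf 0$, $\mathcal R$ (recursor), $\mathcal A$ (universal quantifier combinator); unary $\mathbf S$, $\neg$; unary $\lambda$ (binder count 1, the only binder); binary $=$, $\lor$, and application $\cdot$ (left associative). A term $t$ is well-formed, $\mathrm{wf}(t)$, iff it is built from variables and these ten operators at these arities and binder counts. "Term" means raw term; formulas are just terms. Closed means having no free variables. $\underline n=\mathbf S^n\mathbf 0$ is the numeral of $n$. $[v_i\mapsto s]t$ (also $[i\mapsto s]t$): capture-avoiding replacement of the free variable $v_i$ by $s$, other free variables unchanged. $b[t]$: $\beta$-instance, replacing index $0$ in $b$ by $t$ and decrementing all other free indices. $\uparrow t$: all free indices increased by one; $\uparrow\Gamma$ elementwise. $\mathrm{fv}$: set of free variables. Abbreviations: $t\neq u:=\neg(t=u)$; $t\,\mathsf N:=(t=t)$; $t\,\mathsf B:=(t\lor\neg t)$; $t\land u:=\neg(\neg t\lor\neg u)$. **Head steps** $t\triangleright t'$ (syntactic relation): $(\lambda b)\cdot t\triangleright b[t]$ if $\mathrm{wf}(t)$; $\mathcal R\cdot g\cdot h\cdot\mathbf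 0\triangleright g$ if $\mathrm{wf}(h)$; $\mathcal R\cdot g\cdot h\cdot(\mathbf S\,\underline n)\triangleright h\cdot\underline n\cdot(\mathcal R\cdot g\cdot h\cdot\underline n)$ if $\mathrm{wf}(g)$; and $t\cdot u\triangleright t'\cdot u$ if $t\triangleright t'$. **Proofs.** A judgment $\Gamma\vdash c$ has a finite set $\Gamma$ of terms and a term $c$. A proof is a finite list of judgments each following from earlier entries by one rule below; $P\rhd(\Gamma\vdash c)$ means $P$ is a valid proof containing $\Gamma\vdash c$; a judgment is derivable if some proof contains it. Writing $\Gamma\vdash c$ as an assertion means derivability. Rules ($\Rightarrow$ from premises to conclusion, $\Leftrightarrow$ both directions): Structural: $\mathrm{wf}(c)\Rightarrow\Gamma,c\vdash c$; $\Gamma\vdash c\Rightarrow\Gamma,a\vdash c$; $\Gamma\vdash a$ and $\Gamma,a\vdash c\Rightarrow\Gamma\vdash c$; $\Gamma\vdash c$ with $\Gamma,c,s$ well-formed $\Rightarrow[v\mapsto s]\Gamma\vdash[v\mapsto s]c$. Truth values: $\Gamma\vdash a\Leftrightarrow\Gamma\vdash a=\underline 1$; $\Gamma\vdash\neg a\Leftrightarrow\Gamma\vdash a=\underline 0$. Negation: $\Gamma\vdash\neg a$, $\Gamma\vdash a$, $\mathrm{wf}(c)\Rightarrow\Gamma\vdash c$; $\Gamma\vdash a\Leftrightarrow\Gamma\vdash\neg\neg a$. Disjunction: $\Gamma\vdash a$, $\mathrm{wf}(b)\Rightarrow\Gamma\vdash a\lor b$; $\Gamma\vdash b$, $\mathrm{wf}(a)\Rightarrow\Gamma\vdash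 a\lor b$; $\Gamma\vdash\neg a$, $\Gamma\vdash\neg b\Rightarrow\Gamma\vdash\neg(a\lor b)$; $\Gamma\vdash a\lor b$, $\Gamma,a\vdash c$, $\Gamma,b\vdash c\Rightarrow\Gamma\vdash c$; $\Gamma\vdash\neg(a\lor b)\Rightarrow\Gamma\vdash\neg a$, and $\Rightarrow\Gamma\vdash\neg b$. Equality: $\Gamma\vdash a\,\mathsf N\Leftrightarrow\Gamma\vdash a=a$; $\Gamma\vdash a=b\Rightarrow\Gamma\vdash b=a$; $\Gamma\vdash a=b$, $\Gamma\vdash[v\mapsto a]p$, $\mathrm{wf}(p)\Rightarrow\Gamma\vdash[v\mapsto b]p$; $\Gamma\vdash a\ne b\Rightarrow\Gamma\vdash b\ne a$; $\Gamma\vdash a\,\mathsf N$, $\Gamma\vdash b\,\mathsf N\Rightarrow\Gamma\vdash(a=b)\,\mathsf B$; $\Gamma\vdash(a=b)\,\mathsf B\Rightarrow\Gamma\vdash(a\,\mathsf N)\land(b\,\mathsf N)$. Naturals: $\Gamma\vdash\mathbf 0\,\mathsf N$; $\Gamma\vdash a\,\mathsf N\Leftrightarrow\Gamma\vdash\mathbf S a\,\mathsf N$; $\Gamma\vdash a\,\mathsf N\Rightarrow\Gamma\vdash\mathbf S a\ne\mathbf 0$; $\Gamma\vdash a\ne b\Leftrightarrow\Gamma\vdash\mathbf S a\ne\mathbf S b$; $\Gamma\vdash\mathbf S a=\mathbf S b\Rightarrow\Gamma\vdash a=b$; $\Gamma\vdash\bot\,\mathsf N$, $\mathrm{wf}(p)\Rightarrow\Gamma\vdash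 p$. Induction: $\Gamma\vdash[i\mapsto\mathbf 0]c$; $v_i\,\mathsf N,c,\Gamma\vdash[i\mapsto\mathbf S v_i]c$; $\Gamma\vdash a\,\mathsf N$; $\mathrm{wf}(c)$; $i\notin\mathrm{fv}(\Gamma)$ $\Rightarrow\Gamma\vdash[i\mapsto a]c$. Conversion: if $c\triangleright c'$: $\Gamma\vdash c'\Leftrightarrow\Gamma\vdash c$; $\Gamma\vdash c'\,\mathsf N\Rightarrow\Gamma\vdash c=c'$. Recursor: $\Gamma\vdash m\,\mathsf N$, $\Gamma\vdash(h\cdot m\cdot(\mathcal R\cdot g\cdot h\cdot m))\,\mathsf N$, $\mathrm{wf}(g)\Rightarrow\Gamma\vdash\mathcal R\cdot g\cdot h\cdot(\mathbf S m)=h\cdot m\cdot(\mathcal R\cdot g\cdot h\cdot m)$. Quantifier: $v_0\,\mathsf N,\uparrow\Gamma\vdash\uparrow f\cdot v_0\Rightarrow\Gamma\vdash\mathcal A\cdot f$; $\Gamma\vdash\mathcal A\cdot f$, $\Gamma\vdash a\,\mathsf N\Rightarrow\Gamma\vdash f\cdot a$; $\Gamma\vdash\neg(f\cdot a)$, $\Gamma\vdash a\,\mathsf N\Rightarrow\Gamma\vdash\neg(\mathcal A\cdot f)$; $\Gamma\vdash\neg(\mathcal A\cdot f)$ and $v_0\,\mathsf N,\neg(\uparrow f\cdot v_0),\uparrow\Gamma\vdash\uparrow c\Rightarrow\Gamma\vdash c$. **Evaluation.** Fix a standard effective injective Gödel coding $P\mapsto\ulcorner P\urcorner\in\mathbb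 N$ of proofs. Let $\mathsf{tt}=1$, $\mathsf{ff}=0$. Head shapes $w$ are: $\lambda b$; $\mathcal R$; $\mathcal R\,g$; $\mathcal R\,g\,h$; $\mathcal A$. Value evaluation $t\Downarrow_s r$ ($r,s\in\mathbb N$) and head evaluation $t\Downarrow^{\mathrm{hd}}_s w$ are the least relations on (possibly open) terms such that for all $s$ (there are no clauses for $\bot$ or variables): Values: $\mathbf 0\Downarrow_{s+1}0$; $a\Downarrow_s n\Rightarrow\mathbf S a\Downarrow_{s+1}n+1$; $a\Downarrow_s m$, $b\Downarrow_s n\Rightarrow(a=b)\Downarrow_{s+1}\mathsf{tt}$ if $m=n$ and $\mathsf{ff}$ otherwise; $a\Downarrow_s\mathsf{ff}\Rightarrow\neg a\Downarrow_{s+1}\mathsf{tt}$; $a\Downarrow_s\mathsf{tt}\Rightarrow\neg a\Downarrow_{s+1}\mathsf{ff}$; $a\Downarrow_s\mathsf{tt}$ or $b\Downarrow_s\mathsf{tt}\Rightarrow(a\lor b)\Downarrow_{s+1}\mathsf{tt}$; $a\Downarrow_s\mathsf{ff}$ and $b\Downarrow_s\mathsf{ff}\Rightarrow(a\lor b)\Downarrow_{s+1}\mathsf{ff}$; $t\Downarrow^{\mathrm{hd}}_s\lambda b$, $b[u]\Downarrow_s r\Rightarrow t\cdot u\Downarrow_{s+1}r$; $t\Downarrow^{\mathrm{hd}}_s\mathcal R\,g\,h$, $m\Downarrow_s 0$, $g\Downarrow_s r\Rightarrow t\cdot m\Downarrow_{s+1}r$; $t\Downarrow^{\mathrm{hd}}_s\mathcal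 R\,g\,h$, $m\Downarrow_s k+1$, $h\cdot\underline k\cdot(\mathcal R\cdot g\cdot h\cdot\underline k)\Downarrow_s r\Rightarrow t\cdot m\Downarrow_{s+1}r$. Quantifier: if $t\Downarrow^{\mathrm{hd}}_s\mathcal A$ and $\ulcorner P\urcorner\le s$, then $P\rhd(\{v_0\,\mathsf N\}\vdash\uparrow u\cdot v_0)\Rightarrow t\cdot u\Downarrow_{s+1}\mathsf{tt}$, and $P\rhd(\emptyset\vdash\neg(u\cdot\underline i))$ for some $i\in\mathbb N$ $\Rightarrow t\cdot u\Downarrow_{s+1}\mathsf{ff}$. Heads: $\lambda b\Downarrow^{\mathrm{hd}}_{s+1}\lambda b$; $\mathcal R\Downarrow^{\mathrm{hd}}_{s+1}\mathcal R$; $\mathcal A\Downarrow^{\mathrm{hd}}_{s+1}\mathcal A$; $t\Downarrow^{\mathrm{hd}}_s\mathcal R\Rightarrow t\cdot g\Downarrow^{\mathrm{hd}}_{s+1}\mathcal R\,g$; $t\Downarrow^{\mathrm{hd}}_s\mathcal R\,g\Rightarrow t\cdot h\Downarrow^{\mathrm{hd}}_{s+1}\mathcal R\,g\,h$; and the three clauses for $t\cdot u$, $t\cdot m$ above (heads $\lambda b$ and $\mathcal R\,g\,h$) with the last premise and the conclusion replaced by head evaluation to the same $w$. **Grounded truth.** An assignment is a function $A$ from variables to $\mathbb N\cup\{\bot\}$. The closure of a term $t$ under $A$ is obtained by simultaneously substituting for each free variable $v_i$ the numeral $\underline n$ if $A(v_i)=n\in\mathbb N$, and the term $\bot$ if $A(v_i)=\bot$.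 A term $t$ is grounded true under $A$ if its closure under $A$ evaluates (relation $\Downarrow_s$) to $\mathsf{tt}$ for some $s$. *)

theory Defs
  imports Main "HOL-Library.FSet" "HOL-Library.Nat_Bijection"
begin

section \<open>Raw terms\<close>

text \<open>Raw terms allow arbitrary operator codes, so besides the ten operators of RGA there is a
  supply of codes that occur in no well-formed term.\<close>

datatype opcode =
    OBot | OZero | ORec | OAll | OSuc | ONot | OLam | OEq | OOr | OApp
  | Foreign nat

text \<open>\<open>Op f k ts\<close> has binder count \<open>k\<close>: the indices below \<open>k\<close> are bound in every member of
  \<open>ts\<close>.\<close>

datatype trm = Var nat | Op opcode nat "trm list"

abbreviation tBot :: trm where "tBot \<equiv> Op OBot 0 []"
abbreviation tZero :: trm where "tZero \<equiv> Op OZero 0 []"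
abbreviation tRec :: trm where "tRec \<equiv> Op ORec 0 []"
abbreviation tAll :: trm where "tAll \<equiv> Op OAll 0 []"
abbreviation tSuc :: "trm \<Rightarrow> trm" where "tSuc a \<equiv> Op OSuc 0 [a]"
abbreviation tNot :: "trm \<Rightarrow> trm" where "tNot a \<equiv> Op ONot 0 [a]"
abbreviation tLam :: "trm \<Rightarrow> trm" where "tLam b \<equiv> Op OLam (Suc 0) [b]"
abbreviation tEq :: "trm \<Rightarrow> trm \<Rightarrow> trm" where "tEq a b \<equiv> Op OEq 0 [a, b]"
abbreviation tOr :: "trm \<Rightarrow> trm \<Rightarrow> trm" where "tOr a b \<equiv> Op OOr 0 [a, b]"
abbreviation tApp :: "trm \<Rightarrow> trm \<Rightarrow> trm" (infixl \<open>\<cdot>\<close> 75) where "t \<cdot> u \<equiv> Op OApp 0 [t, u]"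

abbreviation tNeq :: "trm \<Rightarrow> trm \<Rightarrow> trm" where "tNeq a b \<equiv> tNot (tEq a b)"
abbreviation tNat :: "trm \<Rightarrow> trm" where "tNat a \<equiv> tEq a a"
abbreviation tBool :: "trm \<Rightarrow> trm" where "tBool a \<equiv> tOr a (tNot a)"
abbreviation tAnd :: "trm \<Rightarrow> trm \<Rightarrow> trm" where "tAnd a b \<equiv> tNot (tOr (tNot a) (tNot b))"

definition num :: "nat \<Rightarrow> trm" where
  "num n = (tSuc ^^ n) tZero"

text \<open>Binder count and arity of each operator.\<close>

fun signature :: "opcode \<Rightarrow> (nat \<times> nat) option" where
  "signature OBot = Some (0, 0)"
| "signature OZero = Some (0, 0)"
| "signature ORec = Some (0, 0)"
| "signature OAll = Some (0, 0)"
| "signature OSuc = Some (0, 1)"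
| "signature ONot = Some (0, 1)"
| "signature OLam = Some (1, 1)"
| "signature OEq = Some (0, 2)"
| "signature OOr = Some (0, 2)"
| "signature OApp = Some (0, 2)"
| "signature (Foreign n) = None"

fun wft :: "trm \<Rightarrow> bool" where
  "wft (Var i) \<longleftrightarrow> True"
| "wft (Op f k ts) \<longleftrightarrow> signature f = Some (k, length ts) \<and> (\<forall>t\<in>set ts. wft t)"

fun fv :: "trm \<Rightarrow> nat set" where
  "fv (Var i) = {i}"
| "fv (Op f k ts) = {i. \<exists>t\<in>set ts. i + k \<in> fv t}"

section \<open>Renaming and substitution\<close>

text \<open>Renaming and simultaneous substitution of the free variables. Below \<open>k\<close> binders the \<open>k\<close>
  lowest indices are left alone, and a free index \<open>i\<close> of the whole term appears as \<open>i + k\<close>.\<close>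

fun ren :: "(nat \<Rightarrow> nat) \<Rightarrow> trm \<Rightarrow> trm" where
  "ren \<rho> (Var i) = Var (\<rho> i)"
| "ren \<rho> (Op f k ts) = Op f k (map (ren (\<lambda>i. if i < k then i else \<rho> (i - k) + k)) ts)"

fun sub :: "(nat \<Rightarrow> trm) \<Rightarrow> trm \<Rightarrow> trm" where
  "sub \<sigma> (Var i) = \<sigma> i"
| "sub \<sigma> (Op f k ts) =
     Op f k (map (sub (\<lambda>i. if i < k then Var i else ren (\<lambda>j. j + k) (\<sigma> (i - k)))) ts)"

definition shift :: "trm \<Rightarrow> trm" where
  "shift t = ren Suc t"

text \<open>\<open>sub1 v s t\<close> is \<open>t\<close> with the free variable \<open>v\<close> replaced by \<open>s\<close>.\<close>

definition sub1 :: "nat \<Rightarrow> trm \<Rightarrow> trm \<Rightarrow> trm" where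
  "sub1 v s t = sub (Var(v := s)) t"

text \<open>The beta-instance: index 0 of \<open>b\<close> becomes \<open>t\<close>, all other free indices are decremented.\<close>

definition inst :: "trm \<Rightarrow> trm \<Rightarrow> trm" where
  "inst b t = sub (\<lambda>i. case i of 0 \<Rightarrow> t | Suc j \<Rightarrow> Var j) b"

section \<open>Head steps\<close>

inductive head_step :: "trm \<Rightarrow> trm \<Rightarrow> bool" (infix \<open>\<triangleright>\<close> 50) where
  step_beta: "wft t \<Longrightarrow> tLam b \<cdot> t \<triangleright> inst b t"
| step_rec_zero: "wft h \<Longrightarrow> tRec \<cdot> g \<cdot> h \<cdot> tZero \<triangleright> g"
| step_rec_suc: "wft g \<Longrightarrow>
    tRec \<cdot> g \<cdot> h \<cdot> tSuc (num n) \<triangleright> h \<cdot> num n \<cdot> (tRec \<cdot> g \<cdot> h \<cdot> num n)"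
| step_app: "t \<triangleright> t' \<Longrightarrow> t \<cdot> u \<triangleright> t' \<cdot> u"

section \<open>Proofs\<close>

type_synonym sequent = "trm fset \<times> trm"

text \<open>\<open>infer E (\<Gamma>, c)\<close>: the sequent \<open>\<Gamma> \<turnstile> c\<close> follows from sequents in \<open>E\<close> by a single rule.\<close>

inductive infer :: "sequent set \<Rightarrow> sequent \<Rightarrow> bool" for E :: "sequent set" where
  hyp: "wft c \<Longrightarrow> infer E (finsert c \<Gamma>, c)"
| weaken: "(\<Gamma>, c) \<in> E \<Longrightarrow> infer E (finsert a \<Gamma>, c)"
| cut: "(\<Gamma>, a) \<in> E \<Longrightarrow> (finsert a \<Gamma>, c) \<in> E \<Longrightarrow> infer E (\<Gamma>, c)"
| subst: "(\<Gamma>, c) \<in> E \<Longrightarrow> (\<forall>h. h |\<in>| \<Gamma> \<longrightarrow> wft h) \<Longrightarrow> wft c \<Longrightarrow> wft s \<Longrightarrow>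
    infer E (sub1 v s |`| \<Gamma>, sub1 v s c)"

| true_I: "(\<Gamma>, a) \<in> E \<Longrightarrow> infer E (\<Gamma>, tEq a (num 1))"
| true_E: "(\<Gamma>, tEq a (num 1)) \<in> E \<Longrightarrow> infer E (\<Gamma>, a)"
| false_I: "(\<Gamma>, tNot a) \<in> E \<Longrightarrow> infer E (\<Gamma>, tEq a (num 0))"
| false_E: "(\<Gamma>, tEq a (num 0)) \<in> E \<Longrightarrow> infer E (\<Gamma>, tNot a)"

| contradiction: "(\<Gamma>, tNot a) \<in> E \<Longrightarrow> (\<Gamma>, a) \<in> E \<Longrightarrow> wft c \<Longrightarrow> infer E (\<Gamma>, c)"
| not_not_I: "(\<Gamma>, a) \<in> E \<Longrightarrow> infer E (\<Gamma>, tNot (tNot a))"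
| not_not_E: "(\<Gamma>, tNot (tNot a)) \<in> E \<Longrightarrow> infer E (\<Gamma>, a)"

| or_I1: "(\<Gamma>, a) \<in> E \<Longrightarrow> wft b \<Longrightarrow> infer E (\<Gamma>, tOr a b)"
| or_I2: "(\<Gamma>, b) \<in> E \<Longrightarrow> wft a \<Longrightarrow> infer E (\<Gamma>, tOr a b)"
| not_or_I: "(\<Gamma>, tNot a) \<in> E \<Longrightarrow> (\<Gamma>, tNot b) \<in> E \<Longrightarrow> infer E (\<Gamma>, tNot (tOr a b))"
| or_E: "(\<Gamma>, tOr a b) \<in> E \<Longrightarrow> (finsert a \<Gamma>, c) \<in> E \<Longrightarrow> (finsert b \<Gamma>, c) \<in> E \<Longrightarrow>
    infer E (\<Gamma>, c)"
| not_or_E1: "(\<Gamma>, tNot (tOr a b)) \<in> E \<Longrightarrow> infer E (\<Gamma>, tNot a)"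
| not_or_E2: "(\<Gamma>, tNot (tOr a b)) \<in> E \<Longrightarrow> infer E (\<Gamma>, tNot b)"

\<comment> \<open>Both directions of this rule are the same, as \<open>tNat a\<close> abbreviates \<open>tEq a a\<close>.\<close>
| nat_eq: "(\<Gamma>, tNat a) \<in> E \<Longrightarrow> infer E (\<Gamma>, tEq a a)"
| eq_sym: "(\<Gamma>, tEq a b) \<in> E \<Longrightarrow> infer E (\<Gamma>, tEq b a)"
| eq_subst: "(\<Gamma>, tEq a b) \<in> E \<Longrightarrow> (\<Gamma>, sub1 v a p) \<in> E \<Longrightarrow> wft p \<Longrightarrow>
    infer E (\<Gamma>, sub1 v b p)"
| neq_sym: "(\<Gamma>, tNeq a b) \<in> E \<Longrightarrow> infer E (\<Gamma>, tNeq b a)"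
| eq_bool_I: "(\<Gamma>, tNat a) \<in> E \<Longrightarrow> (\<Gamma>, tNat b) \<in> E \<Longrightarrow> infer E (\<Gamma>, tBool (tEq a b))"
| eq_bool_E: "(\<Gamma>, tBool (tEq a b)) \<in> E \<Longrightarrow> infer E (\<Gamma>, tAnd (tNat a) (tNat b))"

| zero_nat: "infer E (\<Gamma>, tNat tZero)"
| suc_nat_I: "(\<Gamma>, tNat a) \<in> E \<Longrightarrow> infer E (\<Gamma>, tNat (tSuc a))"
| suc_nat_E: "(\<Gamma>, tNat (tSuc a)) \<in> E \<Longrightarrow> infer E (\<Gamma>, tNat a)"
| suc_neq_zero: "(\<Gamma>, tNat a) \<in> E \<Longrightarrow> infer E (\<Gamma>, tNeq (tSuc a) tZero)"
| suc_neq_I: "(\<Gamma>, tNeq a b) \<in> E \<Longrightarrow> infer E (\<Gamma>, tNeq (tSuc a) (tSuc b))"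
| suc_neq_E: "(\<Gamma>, tNeq (tSuc a) (tSuc b)) \<in> E \<Longrightarrow> infer E (\<Gamma>, tNeq a b)"
| suc_inj: "(\<Gamma>, tEq (tSuc a) (tSuc b)) \<in> E \<Longrightarrow> infer E (\<Gamma>, tEq a b)"
| bot_nat: "(\<Gamma>, tNat tBot) \<in> E \<Longrightarrow> wft p \<Longrightarrow> infer E (\<Gamma>, p)"

| induction: "(\<Gamma>, sub1 i tZero c) \<in> E \<Longrightarrow>
    (finsert (tNat (Var i)) (finsert c \<Gamma>), sub1 i (tSuc (Var i)) c) \<in> E \<Longrightarrow>
    (\<Gamma>, tNat a) \<in> E \<Longrightarrow> wft c \<Longrightarrow> (\<forall>h. h |\<in>| \<Gamma> \<longrightarrow> i \<notin> fv h) \<Longrightarrow>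
    infer E (\<Gamma>, sub1 i a c)"

| conv_I: "c \<triangleright> c' \<Longrightarrow> (\<Gamma>, c') \<in> E \<Longrightarrow> infer E (\<Gamma>, c)"
| conv_E: "c \<triangleright> c' \<Longrightarrow> (\<Gamma>, c) \<in> E \<Longrightarrow> infer E (\<Gamma>, c')"
| conv_eq: "c \<triangleright> c' \<Longrightarrow> (\<Gamma>, tNat c') \<in> E \<Longrightarrow> infer E (\<Gamma>, tEq c c')"

| rec: "(\<Gamma>, tNat m) \<in> E \<Longrightarrow> (\<Gamma>, tNat (h \<cdot> m \<cdot> (tRec \<cdot> g \<cdot> h \<cdot> m))) \<in> E \<Longrightarrow> wft g \<Longrightarrow>
    infer E (\<Gamma>, tEq (tRec \<cdot> g \<cdot> h \<cdot> tSuc m) (h \<cdot> m \<cdot> (tRec \<cdot> g \<cdot> h \<cdot> m)))"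

| all_I: "(finsert (tNat (Var 0)) (shift |`| \<Gamma>), shift f \<cdot> Var 0) \<in> E \<Longrightarrow>
    infer E (\<Gamma>, tAll \<cdot> f)"
| all_E: "(\<Gamma>, tAll \<cdot> f) \<in> E \<Longrightarrow> (\<Gamma>, tNat a) \<in> E \<Longrightarrow> infer E (\<Gamma>, f \<cdot> a)"
| not_all_I: "(\<Gamma>, tNot (f \<cdot> a)) \<in> E \<Longrightarrow> (\<Gamma>, tNat a) \<in> E \<Longrightarrow>
    infer E (\<Gamma>, tNot (tAll \<cdot> f))"
| not_all_E: "(\<Gamma>, tNot (tAll \<cdot> f)) \<in> E \<Longrightarrow>
    (finsert (tNat (Var 0)) (finsert (tNot (shift f \<cdot> Var 0)) (shift |`| \<Gamma>)), shift c) \<in> E \<Longrightarrow>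
    infer E (\<Gamma>, c)"

definition valid_proof :: "sequent list \<Rightarrow> bool" where
  "valid_proof P \<longleftrightarrow> (\<forall>i<length P. infer (set (take i P)) (P ! i))"

definition proves :: "sequent list \<Rightarrow> sequent \<Rightarrow> bool" where
  "proves P J \<longleftrightarrow> valid_proof P \<and> J \<in> set P"

definition derivable :: "trm fset \<Rightarrow> trm \<Rightarrow> bool" (infix \<open>\<turnstile>\<close> 50) where
  "\<Gamma> \<turnstile> c \<longleftrightarrow> (\<exists>P. proves P (\<Gamma>, c))"

section \<open>Goedel coding of proofs\<close>

text \<open>Built from the Cantor pairing function and the standard codings of lists and finite sets of
  natural numbers.\<close>

fun op_code :: "opcode \<Rightarrow> nat" where
  "op_code OBot = 0"
| "op_code OZero = 1"
| "op_code ORec = 2"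
| "op_code OAll = 3"
| "op_code OSuc = 4"
| "op_code ONot = 5"
| "op_code OLam = 6"
| "op_code OEq = 7"
| "op_code OOr = 8"
| "op_code OApp = 9"
| "op_code (Foreign n) = n + 10"

fun trm_code :: "trm \<Rightarrow> nat" where
  "trm_code (Var i) = sum_encode (Inl i)"
| "trm_code (Op f k ts) =
     sum_encode (Inr (prod_encode (op_code f, prod_encode (k, list_encode (map trm_code ts)))))"

fun sequent_code :: "sequent \<Rightarrow> nat" where
  "sequent_code (\<Gamma>, c) = prod_encode (set_encode (trm_code ` fset \<Gamma>), trm_code c)"

definition proof_code :: "sequent list \<Rightarrow> nat" where
  "proof_code P = list_encode (map sequent_code P)"

lemma op_code_inject: "op_code f = op_code g \<longleftrightarrow> f = g"
  by (cases f; cases g) auto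

lemma trm_code_inject: "trm_code t = trm_code u \<longleftrightarrow> t = u"
proof (induction t arbitrary: u)
  case (Var i)
  show ?case by (cases u) (auto simp: inj_eq[OF inj_sum_encode])
next
  case (Op f k ts)
  show ?case
  proof (cases u)
    case (Var i)
    then show ?thesis by (auto simp: inj_eq[OF inj_sum_encode])
  next
    case u: (Op g l us)
    have "map trm_code ts = map trm_code us \<longleftrightarrow> ts = us"
      using Op.IH by (auto simp: list_eq_iff_nth_eq)
    then show ?thesis
      by (simp add: u inj_eq[OF inj_sum_encode] list_encode_eq op_code_inject)
  qed
qed

lemma inj_sequent_code: "inj sequent_code"
proof (rule injI)
  fix J K assume eq: "sequent_code J = sequent_code K"
  obtain \<Gamma> c \<Delta> d where JK: "J = (\<Gamma>, c)" "K = (\<Delta>, d)" by fastforce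
  have "inj trm_code" by (simp add: inj_def trm_code_inject)
  moreover have "set_encode (trm_code ` fset \<Gamma>) = set_encode (trm_code ` fset \<Delta>)"
    using eq by (simp add: JK)
  then have "trm_code ` fset \<Gamma> = trm_code ` fset \<Delta>"
    by (simp add: set_encode_eq)
  ultimately have "\<Gamma> = \<Delta>" by (simp add: inj_image_eq_iff fset_inject)
  then show "J = K" using eq by (simp add: JK trm_code_inject)
qed

lemma inj_proof_code: "inj proof_code"
  by (auto simp: inj_def proof_code_def list_encode_eq
      intro: map_injective[OF _ inj_sequent_code])

section \<open>Evaluation\<close>

abbreviation tt :: nat where "tt \<equiv> Suc 0"
abbreviation ff :: nat where "ff \<equiv> 0"

datatype head = HLam trm | HRec | HRec1 trm | HRec2 trm trm | HAll

inductive
  veval :: "trm \<Rightarrow> nat \<Rightarrow> nat \<Rightarrow> bool" (\<open>_ \<Down>\<^bsub>_\<^esub> _\<close> [51, 0, 51] 50) and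
  heval :: "trm \<Rightarrow> nat \<Rightarrow> head \<Rightarrow> bool" (\<open>_ \<Down>\<^sup>h\<^bsub>_\<^esub> _\<close> [51, 0, 51] 50)
where
  v_zero: "tZero \<Down>\<^bsub>Suc s\<^esub> 0"
| v_suc: "a \<Down>\<^bsub>s\<^esub> n \<Longrightarrow> tSuc a \<Down>\<^bsub>Suc s\<^esub> Suc n"
| v_eq: "a \<Down>\<^bsub>s\<^esub> m \<Longrightarrow> b \<Down>\<^bsub>s\<^esub> n \<Longrightarrow> tEq a b \<Down>\<^bsub>Suc s\<^esub> (if m = n then tt else ff)"
| v_not_ff: "a \<Down>\<^bsub>s\<^esub> ff \<Longrightarrow> tNot a \<Down>\<^bsub>Suc s\<^esub> tt"
| v_not_tt: "a \<Down>\<^bsub>s\<^esub> tt \<Longrightarrow> tNot a \<Down>\<^bsub>Suc s\<^esub> ff"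
| v_or_tt1: "a \<Down>\<^bsub>s\<^esub> tt \<Longrightarrow> tOr a b \<Down>\<^bsub>Suc s\<^esub> tt"
| v_or_tt2: "b \<Down>\<^bsub>s\<^esub> tt \<Longrightarrow> tOr a b \<Down>\<^bsub>Suc s\<^esub> tt"
| v_or_ff: "a \<Down>\<^bsub>s\<^esub> ff \<Longrightarrow> b \<Down>\<^bsub>s\<^esub> ff \<Longrightarrow> tOr a b \<Down>\<^bsub>Suc s\<^esub> ff"
| v_beta: "t \<Down>\<^sup>h\<^bsub>s\<^esub> HLam b \<Longrightarrow> inst b u \<Down>\<^bsub>s\<^esub> r \<Longrightarrow> t \<cdot> u \<Down>\<^bsub>Suc s\<^esub> r"
| v_rec_zero: "t \<Down>\<^sup>h\<^bsub>s\<^esub> HRec2 g h \<Longrightarrow> m \<Down>\<^bsub>s\<^esub> 0 \<Longrightarrow> g \<Down>\<^bsub>s\<^esub> r \<Longrightarrow> t \<cdot> m \<Down>\<^bsub>Suc s\<^esub> r"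
| v_rec_suc: "t \<Down>\<^sup>h\<^bsub>s\<^esub> HRec2 g h \<Longrightarrow> m \<Down>\<^bsub>s\<^esub> Suc k \<Longrightarrow>
    h \<cdot> num k \<cdot> (tRec \<cdot> g \<cdot> h \<cdot> num k) \<Down>\<^bsub>s\<^esub> r \<Longrightarrow> t \<cdot> m \<Down>\<^bsub>Suc s\<^esub> r"
| v_all_tt: "t \<Down>\<^sup>h\<^bsub>s\<^esub> HAll \<Longrightarrow> proof_code P \<le> s \<Longrightarrow>
    proves P ({|tNat (Var 0)|}, shift u \<cdot> Var 0) \<Longrightarrow> t \<cdot> u \<Down>\<^bsub>Suc s\<^esub> tt"
| v_all_ff: "t \<Down>\<^sup>h\<^bsub>s\<^esub> HAll \<Longrightarrow> proof_code P \<le> s \<Longrightarrow>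
    proves P ({||}, tNot (u \<cdot> num i)) \<Longrightarrow> t \<cdot> u \<Down>\<^bsub>Suc s\<^esub> ff"
| h_lam: "tLam b \<Down>\<^sup>h\<^bsub>Suc s\<^esub> HLam b"
| h_rec: "tRec \<Down>\<^sup>h\<^bsub>Suc s\<^esub> HRec"
| h_all: "tAll \<Down>\<^sup>h\<^bsub>Suc s\<^esub> HAll"
| h_rec1: "t \<Down>\<^sup>h\<^bsub>s\<^esub> HRec \<Longrightarrow> t \<cdot> g \<Down>\<^sup>h\<^bsub>Suc s\<^esub> HRec1 g"
| h_rec2: "t \<Down>\<^sup>h\<^bsub>s\<^esub> HRec1 g \<Longrightarrow> t \<cdot> h \<Down>\<^sup>h\<^bsub>Suc s\<^esub> HRec2 g h"
| h_beta: "t \<Down>\<^sup>h\<^bsub>s\<^esub> HLam b \<Longrightarrow> inst b u \<Down>\<^sup>h\<^bsub>s\<^esub> w \<Longrightarrow> t \<cdot> u \<Down>\<^sup>h\<^bsub>Suc s\<^esub> w"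
| h_rec_zero: "t \<Down>\<^sup>h\<^bsub>s\<^esub> HRec2 g h \<Longrightarrow> m \<Down>\<^bsub>s\<^esub> 0 \<Longrightarrow> g \<Down>\<^sup>h\<^bsub>s\<^esub> w \<Longrightarrow> t \<cdot> m \<Down>\<^sup>h\<^bsub>Suc s\<^esub> w"
| h_rec_suc: "t \<Down>\<^sup>h\<^bsub>s\<^esub> HRec2 g h \<Longrightarrow> m \<Down>\<^bsub>s\<^esub> Suc k \<Longrightarrow>
    h \<cdot> num k \<cdot> (tRec \<cdot> g \<cdot> h \<cdot> num k) \<Down>\<^sup>h\<^bsub>s\<^esub> w \<Longrightarrow> t \<cdot> m \<Down>\<^sup>h\<^bsub>Suc s\<^esub> w"

section \<open>Grounded truth\<close>

text \<open>An assignment maps each variable to a natural number or, via \<open>None\<close>, to bottom.\<close>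

type_synonym assignment = "nat \<Rightarrow> nat option"

definition closure :: "assignment \<Rightarrow> trm \<Rightarrow> trm" where
  "closure A t = sub (\<lambda>i. case A i of Some n \<Rightarrow> num n | None \<Rightarrow> tBot) t"

definition grounded_true :: "assignment \<Rightarrow> trm \<Rightarrow> bool" where
  "grounded_true A t \<longleftrightarrow> (\<exists>s. closure A t \<Down>\<^bsub>s\<^esub> tt)"

end

theory Submission
  imports Defs "HOL-Library.Infinite_Set"
begin

text \<open>
  Induction on derivations does not prove the theorem directly, because of the quantifier. A
  universal formula evaluates to truth when a proof of its generic instance exists, and to falsity
  when a refutation of some numeral instance exists. Eliminating such a formula calls for the
  soundness of that witnessing proof, which is unrelated to the derivation at hand, and may even be
  larger than it: a quantifier introduction assembles its witness from the derivation of its premise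
  and from proofs of its hypotheses.

  The remedy is the relation \<open>ev\<close>, called hereditary evaluation here. It has no stages, and it gives a
  quantified formula a truth value only if, besides the required derivability, the corresponding
  numeral instances (all of them for truth, one of them for falsity) have the appropriate value
  hereditarily. The instances that the elimination rules ask for are thus part of the
  evaluation, and \<open>derivable_sound\<close>, soundness for \<open>ev\<close>, is a plain induction on derivations.
  It rests on three facts:

  \<^item> \<open>ev_deterministic\<close>: values are unique, and nothing has both a value and a head. This settles the
    contradiction rule.
  \<^item> \<open>ev_derivable\<close>: if \<open>t\<close> has value \<open>n\<close>, then \<open>t = n\<close> is derivable without hypotheses. This is needed for
    quantifier introduction, whose witnessing proof may use no hypothesis but \<open>v\<^sub>0 N\<close>: all others are
    true, hence derivable, and can be cut.
  \<^item> \<open>ev_interchange\<close>: closed terms of equal value may replace each other. This settles equality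
    substitution, induction, the recursor rule and instantiation of quantifiers.

  Soundness is stated for all substitutions of closed terms for the variables, which is more than
  assignments provide. The substitution rule forces this: it may instantiate a variable by
  a \<open>\<lambda>\<close>-abstraction, say, which behaves neither like a number nor like \<open>\<bottom>\<close>.

  Once \<open>derivable_sound\<close> is available, the extra demands of \<open>ev\<close> are met by every witnessing proof, so
  that staged and hereditary evaluation agree on closed terms (\<open>closed_veval_iff\<close>), and the theorem
  follows.
\<close>

section \<open>Renaming and substitution\<close>

definition lift :: "nat \<Rightarrow> (nat \<Rightarrow> trm) \<Rightarrow> nat \<Rightarrow> trm" where
  "lift k \<sigma> = (\<lambda>i. if i < k then Var i else ren (\<lambda>j. j + k) (\<sigma> (i - k)))"

lemma sub_Op: "sub \<sigma> (Op f k ts) = Op f k (map (sub (lift k \<sigma>)) ts)"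
  by (simp add: lift_def)

declare sub.simps(2) [simp del] sub_Op [simp]

lemma ren_ident: "ren (\<lambda>i. i) t = t"
  by (induction t) (auto simp: map_idI cong: if_cong)

lemma lift_0 [simp]: "lift 0 \<sigma> = \<sigma>"
  by (simp add: lift_def ren_ident)

lemma ren_cong: "(\<And>i. i \<in> fv t \<Longrightarrow> \<rho> i = \<rho>' i) \<Longrightarrow> ren \<rho> t = ren \<rho>' t"
proof (induction t arbitrary: \<rho> \<rho>')
  case (Op f k ts)
  show ?case
  proof (simp, intro ballI)
    fix t assume t: "t \<in> set ts"
    show "ren (\<lambda>i. if i < k then i else \<rho> (i - k) + k) t
        = ren (\<lambda>i. if i < k then i else \<rho>' (i - k) + k) t"
      using t by (intro Op.IH) (auto intro!: Op.prems bexI[of _ t])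
  qed
qed simp

lemma sub_cong: "(\<And>i. i \<in> fv t \<Longrightarrow> \<sigma> i = \<sigma>' i) \<Longrightarrow> sub \<sigma> t = sub \<sigma>' t"
proof (induction t arbitrary: \<sigma> \<sigma>')
  case (Op f k ts)
  show ?case
  proof (simp, intro ballI)
    fix t assume t: "t \<in> set ts"
    show "sub (lift k \<sigma>) t = sub (lift k \<sigma>') t"
      using t by (intro Op.IH) (auto simp: lift_def intro!: arg_cong[of _ _ "ren _"] Op.prems bexI[of _ t])
  qed
qed simp

lemma sub_Var [simp]: "sub Var t = t"
proof (induction t)
  case (Op f k ts)
  have "lift k Var = Var" by (auto simp: lift_def)
  with Op show ?case by (auto simp: map_idI)
qed simp

lemma ren_ren: "ren \<rho> (ren \<rho>' t) = ren (\<lambda>i. \<rho> (\<rho>' i)) t"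
  by (induction t arbitrary: \<rho> \<rho>') (auto intro!: ren_cong)

lemma sub_ren: "sub \<sigma> (ren \<rho> t) = sub (\<lambda>i. \<sigma> (\<rho> i)) t"
  by (induction t arbitrary: \<sigma> \<rho>) (auto simp: lift_def intro!: sub_cong)

lemma ren_sub: "ren \<rho> (sub \<sigma> t) = sub (\<lambda>i. ren \<rho> (\<sigma> i)) t"
  by (induction t arbitrary: \<sigma> \<rho>) (auto simp: lift_def ren_ren intro!: sub_cong ren_cong)

lemma sub_lift: "sub (lift k \<tau>) (lift k \<sigma> i) = lift k (\<lambda>i. sub \<tau> (\<sigma> i)) i"
  by (auto simp: lift_def sub_ren ren_sub)

lemma sub_sub: "sub \<tau> (sub \<sigma> t) = sub (\<lambda>i. sub \<tau> (\<sigma> i)) t"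
  by (induction t arbitrary: \<sigma> \<tau>) (auto simp: sub_lift)

lemma wft_ren [simp]: "wft (ren \<rho> t) \<longleftrightarrow> wft t"
  by (induction t arbitrary: \<rho>) auto

lemma wft_shift [simp]: "wft (shift t) \<longleftrightarrow> wft t"
  by (simp add: shift_def)

lemma wft_sub: "wft t \<Longrightarrow> (\<And>i. wft (\<sigma> i)) \<Longrightarrow> wft (sub \<sigma> t)"
  by (induction t arbitrary: \<sigma>) (auto simp: lift_def)

text \<open>Renaming and substitution preserve every operator node with its arity, so well-formedness is also
  reflected. This is what makes conclusions of the conversion rules, read backwards, well-formed.\<close>

lemma wft_of_sub: "wft (sub \<sigma> t) \<Longrightarrow> wft t"
  by (induction t arbitrary: \<sigma>) auto

lemma wft_sub1: "wft t \<Longrightarrow> wft s \<Longrightarrow> wft (sub1 v s t)"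
  by (simp add: sub1_def wft_sub)

lemma wft_inst: "wft b \<Longrightarrow> wft t \<Longrightarrow> wft (inst b t)"
  by (simp add: inst_def wft_sub split: nat.split)

lemma wft_of_inst: "wft (inst b t) \<Longrightarrow> wft b"
  unfolding inst_def by (rule wft_of_sub)

lemma finite_fv: "finite (fv t)"
proof (induction t)
  case (Op f k ts)
  have "finite {i. i + k \<in> fv t}" if "t \<in> set ts" for t
    using finite_vimageI[OF Op[OF that], of "\<lambda>i. i + k"] by (simp add: vimage_def)
  moreover have "fv (Op f k ts) = (\<Union>t\<in>set ts. {i. i + k \<in> fv t})" by auto
  ultimately show ?case by simp
qed simp

lemma fv_ren: "fv (ren \<rho> t) = \<rho> ` fv t"
proof (induction t arbitrary: \<rho>)
  case (Op f k ts)
  define \<rho>k where "\<rho>k = (\<lambda>i. if i < k then i else \<rho> (i - k) + k)"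
  have mem: "i \<in> fv (ren \<rho> (Op f k ts)) \<longleftrightarrow> (\<exists>t\<in>set ts. i + k \<in> \<rho>k ` fv t)" for i
    using Op.IH[of _ \<rho>k] by (simp add: \<rho>k_def)
  show ?case
  proof (intro set_eqI iffI)
    fix i assume "i \<in> fv (ren \<rho> (Op f k ts))"
    then obtain t j where t: "t \<in> set ts" "j \<in> fv t" and i: "i + k = \<rho>k j"
      unfolding mem by blast
    then have "i = \<rho> (j - k)" "(j - k) + k = j" by (auto simp: \<rho>k_def split: if_splits)
    moreover from this(2) t have "j - k \<in> fv (Op f k ts)" by auto
    ultimately show "i \<in> \<rho> ` fv (Op f k ts)" by blast
  next
    fix i assume "i \<in> \<rho> ` fv (Op f k ts)"
    then obtain j t where i: "i = \<rho> j" and t: "t \<in> set ts" "j + k \<in> fv t" by auto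
    have "\<rho>k (j + k) = i + k" by (simp add: \<rho>k_def i)
    with t show "i \<in> fv (ren \<rho> (Op f k ts))"
      unfolding mem by (metis imageI)
  qed
qed simp

lemma fv_sub: "fv (sub \<sigma> t) = (\<Union>i\<in>fv t. fv (\<sigma> i))"
proof (induction t arbitrary: \<sigma>)
  case (Op f k ts)
  show ?case
  proof (intro set_eqI iffI)
    fix i assume "i \<in> fv (sub \<sigma> (Op f k ts))"
    then obtain t j where t: "t \<in> set ts" "j \<in> fv t" and i: "i + k \<in> fv (lift k \<sigma> j)"
      using Op.IH by auto
    then have "i \<in> fv (\<sigma> (j - k))" "(j - k) + k = j"
      by (auto simp: lift_def fv_ren split: if_splits)
    moreover from this(2) t have "j - k \<in> fv (Op f k ts)" by auto
    ultimately show "i \<in> (\<Union>i\<in>fv (Op f k ts). fv (\<sigma> i))" by blast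
  next
    fix i assume "i \<in> (\<Union>i\<in>fv (Op f k ts). fv (\<sigma> i))"
    then obtain j t where t: "t \<in> set ts" "j + k \<in> fv t" and i: "i \<in> fv (\<sigma> j)" by auto
    then have "i + k \<in> fv (lift k \<sigma> (j + k))" by (auto simp: lift_def fv_ren)
    then show "i \<in> fv (sub \<sigma> (Op f k ts))"
      using t Op.IH by auto
  qed
qed simp

subsection \<open>Closed terms\<close>

abbreviation closed :: "trm \<Rightarrow> bool" where
  "closed t \<equiv> fv t = {}"

lemma sub_closed: "closed t \<Longrightarrow> sub \<sigma> t = t"
  using sub_cong[of t \<sigma> Var] by simp

lemma sub1_closed: "closed t \<Longrightarrow> sub1 v s t = t"
  by (simp add: sub1_def sub_closed)

lemma shift_closed: "closed t \<Longrightarrow> shift t = t"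
  using ren_cong[of t Suc "\<lambda>i. i"] by (simp add: shift_def ren_ident)

lemma closed_sub: "(\<And>i. closed (\<sigma> i)) \<Longrightarrow> closed (sub \<sigma> t)"
  by (simp add: fv_sub)

lemma num_simps [simp]: "num 0 = tZero" "num (Suc n) = tSuc (num n)"
  by (simp_all add: num_def)

lemma closed_num [simp]: "closed (num n)"
  by (induction n) auto

lemma wft_num [simp]: "wft (num n)"
  by (induction n) auto

lemma sub_num [simp]: "sub \<sigma> (num n) = num n"
  by (simp add: sub_closed)

lemma closed_Op0 [simp]: "closed (Op f 0 ts) \<longleftrightarrow> (\<forall>t\<in>set ts. closed t)"
  by auto

lemma closed_inst: "closed (tLam b) \<Longrightarrow> closed u \<Longrightarrow> closed (inst b u)"
proof -
  assume b: "closed (tLam b)" and u: "closed u"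
  have "closed (case i of 0 \<Rightarrow> u | Suc j \<Rightarrow> Var j)" if "i \<in> fv b" for i
    using b u that by (cases i) auto
  then show ?thesis by (simp add: inst_def fv_sub)
qed

\<comment> \<open>Otherwise \<open>fv\<close> is unfolded before the rule for \<open>closed\<close> can apply.\<close>
declare fv.simps(2) [simp del]

subsection \<open>Interaction of the substitution operations\<close>

lemma sub_sub1: "sub \<sigma> (sub1 v s t) = sub (\<sigma>(v := sub \<sigma> s)) t"
  unfolding sub1_def sub_sub by (rule sub_cong) simp

lemma sub_shift: "sub (case_nat s \<sigma>) (shift t) = sub \<sigma> t"
  by (simp add: shift_def sub_ren)

lemma sub_inst: "sub \<sigma> (inst b t) = inst (sub (lift (Suc 0) \<sigma>) b) (sub \<sigma> t)"
  unfolding inst_def sub_sub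
proof (rule sub_cong)
  fix i
  show "sub \<sigma> (case i of 0 \<Rightarrow> t | Suc j \<Rightarrow> Var j)
      = sub (\<lambda>i. case i of 0 \<Rightarrow> sub \<sigma> t | Suc j \<Rightarrow> Var j) (lift (Suc 0) \<sigma> i)"
    by (cases i) (simp_all add: lift_def sub_ren)
qed

text \<open>Singling out one variable of a closing substitution: this brings its instances into the form
  \<open>sub1 v s p\<close> that the equality rules speak about.\<close>

lemma sub1_sub_closed:
  assumes "\<And>i. closed (\<sigma> i)"
  shows "sub1 v s (sub (\<sigma>(v := Var v)) t) = sub (\<sigma>(v := s)) t"
  unfolding sub1_def sub_sub by (rule sub_cong) (simp add: assms sub_closed)

section \<open>Derivability\<close>

text \<open>The set form of derivability fits the first argument of \<open>infer\<close>, and so allows the rules and the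
  induction principle of \<open>infer\<close> to be carried over to derivability wholesale.\<close>

definition derivables :: "sequent set" where
  "derivables = {J. \<exists>P. proves P J}"

lemma derivable_iff: "(\<Gamma> \<turnstile> c) \<longleftrightarrow> (\<Gamma>, c) \<in> derivables"
  by (simp add: derivable_def derivables_def)

lemma infer_mono: "infer E J \<Longrightarrow> E \<subseteq> F \<Longrightarrow> infer F J"
  by (induction rule: infer.induct) (rule infer.intros; (assumption | erule (1) subsetD[rotated]))+

text \<open>Every rule has at most three premises. This reduces closure of derivability under the rules
  to concatenating finitely many proofs.\<close>

lemma infer_finite: "infer E J \<Longrightarrow> \<exists>F. finite F \<and> F \<subseteq> E \<and> infer F J"
proof -
  let ?fin = "\<lambda>J. \<exists>F. finite F \<and> F \<subseteq> E \<and> infer F J"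
  have fin0: "infer {} J \<Longrightarrow> ?fin J" for J by blast
  have fin1: "J1 \<in> E \<Longrightarrow> infer {J1} J \<Longrightarrow> ?fin J" for J J1 by blast
  have fin2: "J1 \<in> E \<Longrightarrow> J2 \<in> E \<Longrightarrow> infer {J1, J2} J \<Longrightarrow> ?fin J" for J J1 J2
    by (intro exI[of _ "{J1, J2}"]) simp
  have fin3: "J1 \<in> E \<Longrightarrow> J2 \<in> E \<Longrightarrow> J3 \<in> E \<Longrightarrow> infer {J1, J2, J3} J \<Longrightarrow> ?fin J" for J J1 J2 J3
    by (intro exI[of _ "{J1, J2, J3}"]) simp
  \<comment> \<open>One alternative per number of premises; the premises are looked up in the enumerated set.\<close>
  show "infer E J \<Longrightarrow> ?fin J"
  proof (induction rule: infer.induct)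
  qed ((rule fin0, rule infer.intros; assumption)
    | (rule fin1, assumption, rule infer.intros; (assumption | rule insertI1))
    | (rule fin2, assumption, assumption, rule infer.intros;
        (assumption | rule insertI1 insertI2[OF insertI1]))
    | (rule fin3, assumption, assumption, assumption, rule infer.intros;
        (assumption | rule insertI1 insertI2[OF insertI1] insertI2[OF insertI2[OF insertI1]])))+
qed

lemma valid_proof_append: "valid_proof P \<Longrightarrow> valid_proof Q \<Longrightarrow> valid_proof (P @ Q)"
proof -
  assume P: "valid_proof P" and Q: "valid_proof Q"
  show ?thesis
    unfolding valid_proof_def
  proof (intro allI impI)
    fix i assume i: "i < length (P @ Q)"
    show "infer (set (take i (P @ Q))) ((P @ Q) ! i)"
    proof (cases "i < length P")
      case True
      with P show ?thesis by (simp add: valid_proof_def nth_append)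
    next
      case False
      with i Q have "infer (set (take (i - length P) Q)) (Q ! (i - length P))"
        by (simp add: valid_proof_def)
      with False show ?thesis by (auto simp: nth_append elim: infer_mono)
    qed
  qed
qed

lemma joint_proof: "finite F \<Longrightarrow> F \<subseteq> derivables \<Longrightarrow> \<exists>P. valid_proof P \<and> F \<subseteq> set P"
proof (induction rule: finite_induct)
  case empty
  have "valid_proof []" by (simp add: valid_proof_def)
  then show ?case by blast
next
  case (insert J F)
  then obtain P Q where "valid_proof P" "J \<in> set P" "valid_proof Q" "F \<subseteq> set Q"
    by (auto simp: derivables_def proves_def)
  then show ?case by (intro exI[of _ "P @ Q"]) (auto intro: valid_proof_append)
qed

theorem infer_derivables: "infer derivables J \<Longrightarrow> J \<in> derivables"
proof -
  assume "infer derivables J"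
  then obtain F where "finite F" "F \<subseteq> derivables" and J: "infer F J"
    using infer_finite by blast
  then obtain P where P: "valid_proof P" "F \<subseteq> set P" using joint_proof by blast
  have "valid_proof (P @ [J])"
    unfolding valid_proof_def
  proof (intro allI impI)
    fix i assume "i < length (P @ [J])"
    then consider "i < length P" | "i = length P" by fastforce
    then show "infer (set (take i (P @ [J]))) ((P @ [J]) ! i)"
      using P infer_mono[OF J] by cases (auto simp: valid_proof_def nth_append)
  qed
  then show "J \<in> derivables" unfolding derivables_def proves_def by force
qed

theorem derivables_induct:
  assumes J: "J \<in> derivables"
    and step: "\<And>J. infer {J \<in> derivables. Q J} J \<Longrightarrow> J \<in> derivables \<Longrightarrow> Q J"
  shows "Q J"
proof -
  obtain P where P: "valid_proof P" "J \<in> set P"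
    using J by (auto simp: derivables_def proves_def)
  have "Q (P ! i)" if "i < length P" for i
    using that
  proof (induction i rule: less_induct)
    case (less i)
    have "set P \<subseteq> derivables" using P(1) by (auto simp: derivables_def proves_def simp del: split_paired_All)
    moreover have "Q J" if "J \<in> set (take i P)" for J
      using less that by (auto simp: in_set_conv_nth)
    ultimately have "set (take i P) \<subseteq> {J \<in> derivables. Q J}"
      using set_take_subset by fast
    moreover have "infer (set (take i P)) (P ! i)"
      using P(1) less.prems by (simp add: valid_proof_def)
    ultimately have "infer {J \<in> derivables. Q J} (P ! i)" by (rule infer_mono[rotated])
    with less.prems \<open>set P \<subseteq> derivables\<close> show ?case by (intro step) auto
  qed
  with P(2) show ?thesis by (auto simp: in_set_conv_nth)
qed

text \<open>Besides the induction hypothesis \<open>Q\<close>, each premise is known to be derivable. Both are used together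
  in the soundness proof, where quantifier introduction needs the derivation itself.\<close>

lemma derivable_induct [consumes 1, case_names infer]:
  assumes "\<Gamma> \<turnstile> c"
    and "\<And>\<Gamma> c. infer {(\<Gamma>, c). (\<Gamma> \<turnstile> c) \<and> Q \<Gamma> c} (\<Gamma>, c) \<Longrightarrow> Q \<Gamma> c"
  shows "Q \<Gamma> c"
proof -
  have set_eq: "{J \<in> derivables. case_prod Q J} = {(\<Gamma>, c). (\<Gamma> \<turnstile> c) \<and> Q \<Gamma> c}"
    by (auto simp: derivable_iff)
  have "(\<Gamma>, c) \<in> derivables" using assms(1) by (simp add: derivable_iff)
  then have "case_prod Q (\<Gamma>, c)"
  proof (rule derivables_induct)
    fix J assume "infer {J \<in> derivables. case_prod Q J} J"
    with assms(2) show "case_prod Q J" by (cases J) (simp only: set_eq prod.case)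
  qed
  then show ?thesis by simp
qed

lemmas derivable_weaken = infer.weaken[THEN infer_derivables, folded derivable_iff]
  and derivable_cut = infer.cut[THEN infer_derivables, folded derivable_iff]
  and derivable_subst = infer.subst[THEN infer_derivables, folded derivable_iff]
  and derivable_true_I = infer.true_I[THEN infer_derivables, folded derivable_iff]
  and derivable_true_E = infer.true_E[THEN infer_derivables, folded derivable_iff]
  and derivable_false_I = infer.false_I[THEN infer_derivables, folded derivable_iff]
  and derivable_false_E = infer.false_E[THEN infer_derivables, folded derivable_iff]
  and derivable_not_not_I = infer.not_not_I[THEN infer_derivables, folded derivable_iff]
  and derivable_or_I1 = infer.or_I1[THEN infer_derivables, folded derivable_iff]
  and derivable_or_I2 = infer.or_I2[THEN infer_derivables, folded derivable_iff]
  and derivable_not_or_I = infer.not_or_I[THEN infer_derivables, folded derivable_iff]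
  and derivable_eq_sym = infer.eq_sym[THEN infer_derivables, folded derivable_iff]
  and derivable_eq_subst = infer.eq_subst[THEN infer_derivables, folded derivable_iff]
  and derivable_neq_sym = infer.neq_sym[THEN infer_derivables, folded derivable_iff]
  and derivable_zero_nat = infer.zero_nat[THEN infer_derivables, folded derivable_iff]
  and derivable_suc_nat_I = infer.suc_nat_I[THEN infer_derivables, folded derivable_iff]
  and derivable_suc_neq_zero = infer.suc_neq_zero[THEN infer_derivables, folded derivable_iff]
  and derivable_suc_neq_I = infer.suc_neq_I[THEN infer_derivables, folded derivable_iff]
  and derivable_conv_eq = infer.conv_eq[THEN infer_derivables, folded derivable_iff]
  and derivable_all_I = infer.all_I[THEN infer_derivables, folded derivable_iff]
  and derivable_not_all_I = infer.not_all_I[THEN infer_derivables, folded derivable_iff]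

lemma head_step_wft: "c \<triangleright> c' \<Longrightarrow> wft c' \<longleftrightarrow> wft c"
proof (induction rule: head_step.induct)
  case (step_beta t b)
  then show ?case using wft_inst[of b t] wft_of_inst[of b t] by auto
qed auto

lemma infer_wft: "infer E (\<Gamma>, c) \<Longrightarrow> (\<And>\<Delta> d. (\<Delta>, d) \<in> E \<Longrightarrow> wft d) \<Longrightarrow> wft c"
proof (induction "(\<Gamma>, c)" arbitrary: \<Gamma> c rule: infer.induct)
  case (conv_I c c' \<Gamma>)
  then show ?case using head_step_wft by blast
next
  case (conv_E c c' \<Gamma>)
  then show ?case using head_step_wft by blast
next
  case (conv_eq c c' \<Gamma>)
  from conv_eq(3)[OF conv_eq(2)] head_step_wft[OF conv_eq(1)] show ?case by simp
qed (fastforce intro: wft_sub1)+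

lemma derivable_wft: "\<Gamma> \<turnstile> c \<Longrightarrow> wft c"
proof (induction rule: derivable_induct)
  case (infer \<Gamma> c)
  then show ?case by (rule infer_wft) blast
qed

lemma wft_shift_image: "ffilter wft (shift |`| \<Gamma>) = shift |`| ffilter wft \<Gamma>"
  by (rule fset_eqI) auto

lemma ffilter_wft_finsert:
  "wft a \<Longrightarrow> ffilter wft (finsert a \<Gamma>) = finsert a (ffilter wft \<Gamma>)"
  "\<not> wft a \<Longrightarrow> ffilter wft (finsert a \<Gamma>) = ffilter wft \<Gamma>"
  by (rule fset_eqI, auto)+

text \<open>An ill-formed hypothesis can enter a sequent only by weakening: \<open>hyp\<close> requires a well-formed formula,
  and the hypotheses that rules discharge are well-formed because conclusions are. Dropping such
  hypotheses makes the substitution rule, which requires well-formed hypotheses, applicable in general.\<close>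

lemma derivable_from_wft: "\<Gamma> \<turnstile> c \<Longrightarrow> ffilter wft \<Gamma> \<turnstile> c"
proof (induction rule: derivable_induct)
  case (infer \<Gamma> c)
  define E where "E = {(\<Gamma>, c). (\<Gamma> \<turnstile> c) \<and> (ffilter wft \<Gamma> \<turnstile> c)}"
  have E: "\<Delta>' = ffilter wft \<Delta> \<Longrightarrow> (\<Delta>', d) \<in> derivables" if "(\<Delta>, d) \<in> E" for \<Delta> \<Delta>' d
    using that by (simp add: E_def derivable_iff)
  have wft: "wft d" if "(\<Delta>, d) \<in> E" for \<Delta> d
    using that by (auto simp: E_def dest: derivable_wft)
  have "infer E (\<Gamma>, c)" using infer by (simp add: E_def)
  then have "(ffilter wft \<Gamma>, c) \<in> derivables"
  proof (induction "(\<Gamma>, c)" arbitrary: \<Gamma> c rule: infer.induct)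
    case (hyp c \<Gamma>)
    then show ?case
      by (auto simp: ffilter_wft_finsert intro!: infer_derivables infer.hyp)
  next
    case (weaken \<Gamma> c a)
    then show ?case
      using E[OF weaken refl] infer.weaken[THEN infer_derivables]
      by (cases "wft a") (auto simp: ffilter_wft_finsert)
  next
    case (subst \<Gamma> c s v)
    have "ffilter wft (sub1 v s |`| \<Gamma>) = sub1 v s |`| \<Gamma>"
      using subst by (intro fset_eqI) (auto simp: wft_sub1)
    moreover have "(\<Gamma>, c) \<in> derivables"
      using subst.hyps(1) by (auto simp: E_def derivable_iff)
    ultimately show ?case
      using infer.subst[THEN infer_derivables] subst by simp
  next
    case (induction \<Gamma> i c a)
    show ?case
      by (rule infer_derivables, rule infer.induction)
        (use induction in \<open>auto simp: ffilter_wft_finsert intro: E\<close>)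
  next
    case (not_all_E \<Gamma> f c)
    have "wft f" using wft[OF not_all_E(1)] by simp
    then show ?case
      by (intro infer_derivables infer.not_all_E[OF E[OF not_all_E(1)] E[OF not_all_E(2)]])
        (simp_all add: ffilter_wft_finsert wft_shift_image)
  qed (rule infer_derivables, rule infer.intros;
    (assumption | (rule E, assumption, auto simp: ffilter_wft_finsert wft_shift_image dest!: wft; fail)))+
  then show ?case by (simp add: derivable_iff)
qed

text \<open>The rule replaces one variable at a time. Since the terms put in are closed (or leave the variable
  as it is), no replacement disturbs an earlier one, and replacing the variables in increasing order
  up to a bound on the free ones has the effect of the simultaneous substitution.\<close>

lemma derivable_sub:
  assumes der: "\<Gamma> \<turnstile> c" and wf: "\<And>h. h |\<in>| \<Gamma> \<Longrightarrow> wft h"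
    and \<sigma>_wft: "\<And>i. wft (\<sigma> i)" and \<sigma>_closed: "\<And>i. closed (\<sigma> i) \<or> \<sigma> i = Var i"
  shows "sub \<sigma> |`| \<Gamma> \<turnstile> sub \<sigma> c"
proof -
  define upto where "upto n = (\<lambda>i. if i < n then \<sigma> i else Var i)" for n
  have upto_wft: "wft (upto n i)" for n i by (simp add: upto_def \<sigma>_wft)
  have sub1_upto: "sub1 n (\<sigma> n) (sub (upto n) t) = sub (upto (Suc n)) t" for n t
    unfolding sub1_def sub_sub
  proof (rule sub_cong)
    fix i
    consider "i < n" "closed (\<sigma> i)" | "i < n" "\<sigma> i = Var i" | "i = n" | "i > n"
      using \<sigma>_closed[of i] by fastforce
    then show "sub (Var(n := \<sigma> n)) (upto n i) = upto (Suc n) i"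
      by cases (simp_all add: upto_def sub_closed)
  qed
  have steps: "sub (upto n) |`| \<Gamma> \<turnstile> sub (upto n) c" for n
  proof (induction n)
    case 0
    have "upto 0 = Var" by (simp add: upto_def)
    moreover have "sub Var = id" by auto
    ultimately show ?case using der by simp
  next
    case (Suc n)
    have "sub1 n (\<sigma> n) |`| sub (upto n) |`| \<Gamma> \<turnstile> sub1 n (\<sigma> n) (sub (upto n) c)"
      using wf derivable_wft[OF der]
      by (intro derivable_subst Suc) (auto simp: \<sigma>_wft upto_wft wft_sub)
    then show ?case by (simp add: fset.map_comp comp_def sub1_upto)
  qed
  have "finite (\<Union>t\<in>fset (finsert c \<Gamma>). fv t)" by (simp add: finite_fv)
  then obtain n where n: "\<forall>i\<in>(\<Union>t\<in>fset (finsert c \<Gamma>). fv t). i < n"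
    unfolding finite_nat_set_iff_bounded ..
  have "sub (upto n) t = sub \<sigma> t" if "t |\<in>| finsert c \<Gamma>" for t
    by (rule sub_cong) (use n that in \<open>auto simp: upto_def\<close>)
  moreover from this have "sub (upto n) |`| \<Gamma> = sub \<sigma> |`| \<Gamma>" by (intro fset.map_cong0) simp
  ultimately show ?thesis using steps[of n] by simp
qed

lemma derivable_weaken_all: "{||} \<turnstile> c \<Longrightarrow> \<Gamma> \<turnstile> c"
  by (induction \<Gamma>) (assumption, rule derivable_weaken)

lemma derivable_cut_all:
  assumes "\<Delta> |\<union>| \<Gamma> \<turnstile> c" and "\<And>h. h |\<in>| \<Delta> \<Longrightarrow> {||} \<turnstile> h"
  shows "\<Gamma> \<turnstile> c"
  using assms
proof (induction \<Delta>)
  case (insert h \<Delta>)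
  have h: "{||} \<turnstile> h" by (rule insert.prems(2)) simp
  have "finsert h (\<Delta> |\<union>| \<Gamma>) \<turnstile> c" using insert.prems(1) by simp
  then have "\<Delta> |\<union>| \<Gamma> \<turnstile> c" by (rule derivable_cut[OF derivable_weaken_all[OF h]])
  then show ?case
  proof (rule insert.IH)
    show "{||} \<turnstile> h'" if "h' |\<in>| \<Delta>" for h' using that by (intro insert.prems(2)) simp
  qed
qed simp

subsection \<open>Equality\<close>

lemma sub1_Op0 [simp]: "sub1 v s (Op f 0 ts) = Op f 0 (map (sub1 v s) ts)"
  by (simp add: sub1_def)

lemma sub1_Var [simp]: "sub1 v s (Var i) = (if i = v then s else Var i)"
  by (simp add: sub1_def)

lemma sub1_num [simp]: "sub1 v s (num n) = num n"
  by (simp add: sub1_closed)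

lemma sub1_fresh: "v \<notin> fv t \<Longrightarrow> sub1 v s t = t"
  unfolding sub1_def by (rule sub_cong[of t _ Var, simplified]) auto

lemma fresh_variable: "\<exists>v. \<forall>t\<in>set ts. v \<notin> fv t"
proof -
  have "finite (\<Union>t\<in>set ts. fv t)" by (simp add: finite_fv)
  then obtain v where "v \<notin> (\<Union>t\<in>set ts. fv t)" using ex_new_if_finite by blast
  then show ?thesis by blast
qed

lemma derivable_eq_trans:
  assumes "\<Gamma> \<turnstile> tEq a b" and "\<Gamma> \<turnstile> tEq b c"
  shows "\<Gamma> \<turnstile> tEq a c"
proof -
  obtain v where v: "v \<notin> fv a" using fresh_variable[of "[a]"] by auto
  have "\<Gamma> \<turnstile> sub1 v c (tEq a (Var v))"
    using assms derivable_wft[OF assms(1)]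
    by (intro derivable_eq_subst[OF assms(2)]) (simp_all add: sub1_fresh[OF v])
  then show ?thesis by (simp add: sub1_fresh[OF v])
qed

lemma derivable_nat: "\<Gamma> \<turnstile> tEq a b \<Longrightarrow> \<Gamma> \<turnstile> tNat a"
  by (rule derivable_eq_trans[OF _ derivable_eq_sym])

lemma derivable_num_nat: "\<Gamma> \<turnstile> tNat (num n)"
  by (induction n) (simp_all add: derivable_zero_nat derivable_suc_nat_I)

lemma derivable_num_neq: "m \<noteq> n \<Longrightarrow> \<Gamma> \<turnstile> tNeq (num m) (num n)"
proof (induction m arbitrary: n)
  case 0
  then obtain k where "n = Suc k" by (cases n) auto
  then show ?case
    using derivable_neq_sym[OF derivable_suc_neq_zero[OF derivable_num_nat]] by simp
next
  case (Suc m)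
  show ?case
  proof (cases n)
    case 0
    then show ?thesis using derivable_suc_neq_zero[OF derivable_num_nat] by simp
  next
    case (Suc k)
    then show ?thesis using Suc.IH[of k] Suc.prems by (simp add: derivable_suc_neq_I)
  qed
qed

lemma derivable_suc_num:
  assumes "\<Gamma> \<turnstile> tEq a (num n)"
  shows "\<Gamma> \<turnstile> tEq (tSuc a) (num (Suc n))"
proof -
  have "\<Gamma> \<turnstile> sub1 0 a (tEq (tSuc (Var 0)) (num (Suc n)))"
    by (rule derivable_eq_subst[OF derivable_eq_sym[OF assms]])
      (use derivable_num_nat[of _ "Suc n"] in simp_all)
  then show ?thesis by simp
qed

lemma derivable_neq_num:
  assumes "\<Gamma> \<turnstile> tEq a (num m)" and "\<Gamma> \<turnstile> tEq b (num n)" and "m \<noteq> n"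
  shows "\<Gamma> \<turnstile> tNeq a b"
proof -
  obtain v where v: "v \<notin> fv a" using fresh_variable[of "[a]"] by auto
  have "\<Gamma> \<turnstile> sub1 0 a (tNeq (Var 0) (num n))"
    by (rule derivable_eq_subst[OF derivable_eq_sym[OF assms(1)]])
      (use derivable_num_neq[OF assms(3)] in simp_all)
  then have "\<Gamma> \<turnstile> sub1 v b (tNeq a (Var v))"
    using derivable_wft[OF assms(1)]
    by (intro derivable_eq_subst[OF derivable_eq_sym[OF assms(2)]]) (simp_all add: sub1_fresh[OF v])
  then show ?thesis by (simp add: sub1_fresh[OF v])
qed

lemma derivable_conv_trans: "c \<triangleright> c' \<Longrightarrow> \<Gamma> \<turnstile> tEq c' a \<Longrightarrow> \<Gamma> \<turnstile> tEq c a"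
  by (rule derivable_eq_trans[OF derivable_conv_eq[OF _ derivable_nat]])

subsection \<open>Application spines\<close>

text \<open>Head steps happen at the head of an application, below any number of further arguments. The
  statements about heads are therefore quantified over the list of these arguments.\<close>

abbreviation spine :: "trm \<Rightarrow> trm list \<Rightarrow> trm" where
  "spine \<equiv> foldl (\<lambda>t u. t \<cdot> u)"

lemma wft_spine [simp]: "wft (spine t us) \<longleftrightarrow> wft t \<and> (\<forall>u\<in>set us. wft u)"
  by (induction us arbitrary: t) auto

lemma sub1_spine: "sub1 v s (spine t us) = spine (sub1 v s t) (map (sub1 v s) us)"
  by (induction us arbitrary: t) simp_all

lemma head_step_spine: "t \<triangleright> t' \<Longrightarrow> spine t us \<triangleright> spine t' us"
  by (induction us arbitrary: t t') (simp_all add: step_app)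

text \<open>The rule \<open>eq_subst\<close> needs a template with a marked variable. A fresh one marks just the
  argument \<open>m\<close>, and not other occurrences of it in \<open>t\<close> or \<open>us\<close>.\<close>

lemma derivable_eq_argument:
  assumes eq: "\<Gamma> \<turnstile> tEq m m'" and der: "\<Gamma> \<turnstile> tEq (spine (t \<cdot> m) us) (num r)"
  shows "\<Gamma> \<turnstile> tEq (spine (t \<cdot> m') us) (num r)"
proof -
  obtain v where v: "\<forall>u\<in>set (t # us). v \<notin> fv u" using fresh_variable by blast
  then have us: "map (sub1 v s) us = us" for s
    by (intro map_idI) (simp add: sub1_fresh)
  have "\<Gamma> \<turnstile> sub1 v m' (tEq (spine (t \<cdot> Var v) us) (num r))"
    using der derivable_wft[OF der] v
    by (intro derivable_eq_subst[OF eq]) (simp_all add: sub1_spine us sub1_fresh)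
  then show ?thesis using v by (simp add: sub1_spine us sub1_fresh)
qed

section \<open>Hereditary evaluation\<close>

text \<open>The clauses are those of staged evaluation without the stages, except for the quantifier:
  \<open>e_all_tt\<close> and \<open>e_all_ff\<close> ask in addition for the values of the numeral instances. The infinitely many
  premises of \<open>e_all_tt\<close> are the reason for having no stages: no finite stage would bound them.\<close>

inductive ev :: "trm \<Rightarrow> nat \<Rightarrow> bool" and evh :: "trm \<Rightarrow> head \<Rightarrow> bool" where
  e_zero: "ev tZero 0"
| e_suc: "ev a n \<Longrightarrow> ev (tSuc a) (Suc n)"
| e_eq: "ev a m \<Longrightarrow> ev b n \<Longrightarrow> ev (tEq a b) (if m = n then tt else ff)"
| e_not_ff: "ev a ff \<Longrightarrow> ev (tNot a) tt"
| e_not_tt: "ev a tt \<Longrightarrow> ev (tNot a) ff"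
| e_or_tt1: "ev a tt \<Longrightarrow> ev (tOr a b) tt"
| e_or_tt2: "ev b tt \<Longrightarrow> ev (tOr a b) tt"
| e_or_ff: "ev a ff \<Longrightarrow> ev b ff \<Longrightarrow> ev (tOr a b) ff"
| e_beta: "evh t (HLam b) \<Longrightarrow> ev (inst b u) r \<Longrightarrow> ev (t \<cdot> u) r"
| e_rec_zero: "evh t (HRec2 g h) \<Longrightarrow> ev m 0 \<Longrightarrow> ev g r \<Longrightarrow> ev (t \<cdot> m) r"
| e_rec_suc: "evh t (HRec2 g h) \<Longrightarrow> ev m (Suc k) \<Longrightarrow>
    ev (h \<cdot> num k \<cdot> (tRec \<cdot> g \<cdot> h \<cdot> num k)) r \<Longrightarrow> ev (t \<cdot> m) r"
| e_all_tt: "evh t HAll \<Longrightarrow> {|tNat (Var 0)|} \<turnstile> shift u \<cdot> Var 0 \<Longrightarrow>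
    (\<And>n. ev (u \<cdot> num n) tt) \<Longrightarrow> ev (t \<cdot> u) tt"
| e_all_ff: "evh t HAll \<Longrightarrow> {||} \<turnstile> tNot (u \<cdot> num i) \<Longrightarrow> ev (u \<cdot> num i) ff \<Longrightarrow> ev (t \<cdot> u) ff"
| eh_lam: "evh (tLam b) (HLam b)"
| eh_rec: "evh tRec HRec"
| eh_all: "evh tAll HAll"
| eh_rec1: "evh t HRec \<Longrightarrow> evh (t \<cdot> g) (HRec1 g)"
| eh_rec2: "evh t (HRec1 g) \<Longrightarrow> evh (t \<cdot> h) (HRec2 g h)"
| eh_beta: "evh t (HLam b) \<Longrightarrow> evh (inst b u) w \<Longrightarrow> evh (t \<cdot> u) w"
| eh_rec_zero: "evh t (HRec2 g h) \<Longrightarrow> ev m 0 \<Longrightarrow> evh g w \<Longrightarrow> evh (t \<cdot> m) w"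
| eh_rec_suc: "evh t (HRec2 g h) \<Longrightarrow> ev m (Suc k) \<Longrightarrow>
    evh (h \<cdot> num k \<cdot> (tRec \<cdot> g \<cdot> h \<cdot> num k)) w \<Longrightarrow> evh (t \<cdot> m) w"

inductive_simps ev_simps [simp]:
  "ev tZero r" "ev (tSuc a) r" "ev (tNot a) r" "ev (tOr a b) r"
  "ev tBot r" "ev (tLam b) r" "ev tRec r" "ev tAll r"

inductive_simps evh_simps [simp]:
  "evh tZero w" "evh (tSuc a) w" "evh (tEq a b) w" "evh (tNot a) w" "evh (tOr a b) w"
  "evh (tLam b) w" "evh tRec w" "evh tAll w"

inductive_simps ev_Eq: "ev (tEq a b) r"
inductive_simps ev_App: "ev (t \<cdot> u) r"
inductive_simps evh_App: "evh (t \<cdot> u) w"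

text \<open>A quantified formula cannot have both values, because its instance at the refuted numeral would; and
  that instance is covered by the induction hypothesis. For staged evaluation, this case would require
  consistency of the derivation system. The equivalences (rather than implications) turn the
  induction hypotheses into rewrite rules.\<close>

lemma ev_deterministic:
  "ev t r \<Longrightarrow> (\<forall>r'. ev t r' \<longleftrightarrow> r' = r) \<and> (\<forall>w. \<not> evh t w)"
  "evh t w \<Longrightarrow> (\<forall>w'. evh t w' \<longleftrightarrow> w' = w) \<and> (\<forall>r. \<not> ev t r)"
proof (induction rule: ev_evh.inducts)
  case (e_beta t b u r)
  then show ?case by (simp add: ev_App[of t u] evh_App[of t u])
next
  case (e_rec_zero t g h m r)
  then show ?case by (simp add: ev_App[of t m] evh_App[of t m])
next
  case (e_rec_suc t g h m k r)
  then show ?case by (simp add: ev_App[of t m] evh_App[of t m])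
next
  case (e_all_tt t u)
  then show ?case by (simp add: ev_App[of t u] evh_App[of t u])
next
  case (eh_rec1 t g)
  then show ?case by (simp add: ev_App[of t g] evh_App[of t g])
next
  case (eh_rec2 t g h)
  then show ?case by (simp add: ev_App[of t h] evh_App[of t h])
next
  case (eh_beta t b u w)
  then show ?case by (simp add: ev_App[of t u] evh_App[of t u])
next
  case (eh_rec_zero t g h m w)
  then show ?case by (simp add: ev_App[of t m] evh_App[of t m])
next
  case (eh_rec_suc t g h m k w)
  then show ?case by (simp add: ev_App[of t m] evh_App[of t m])
next
  case (e_all_ff t u i)
  have "\<not> (\<forall>n. ev (u \<cdot> num n) tt)" using e_all_ff.IH(2) by (metis nat.distinct(1))
  then show ?case using e_all_ff by (auto simp: ev_App[of t u] evh_App[of t u])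
qed (auto simp: ev_Eq)

lemma ev_unique: "ev t r \<Longrightarrow> ev t r' \<Longrightarrow> r = r'"
  using ev_deterministic(1) by blast

lemma ev_not_evh: "ev t r \<Longrightarrow> \<not> evh t w"
  using ev_deterministic(1) by blast

lemma ev_num [simp]: "ev (num n) r \<longleftrightarrow> r = n"
  by (induction n arbitrary: r) auto

subsection \<open>Evaluations are derivable\<close>

fun head_trm :: "head \<Rightarrow> trm" where
  "head_trm (HLam b) = tLam b"
| "head_trm HRec = tRec"
| "head_trm (HRec1 g) = tRec \<cdot> g"
| "head_trm (HRec2 g h) = tRec \<cdot> g \<cdot> h"
| "head_trm HAll = tAll"

text \<open>Heads are not values, so \<open>t\<close> and the head term \<open>t'\<close> cannot be proved equal. What can be proved
  instead is that whatever value \<open>t'\<close> applied to some arguments provably has is also provably the value of \<open>t\<close>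
  applied to them.\<close>

definition transfers :: "trm \<Rightarrow> trm \<Rightarrow> bool" where
  "transfers t t' \<longleftrightarrow>
     (\<forall>us n. ({||} \<turnstile> tEq (spine t' us) (num n)) \<longrightarrow> ({||} \<turnstile> tEq (spine t us) (num n)))"

lemma transfers_refl: "transfers t t"
  by (simp add: transfers_def)

lemma transfers_trans [trans]: "transfers t t' \<Longrightarrow> transfers t' t'' \<Longrightarrow> transfers t t''"
  by (simp add: transfers_def)

lemma transfersD:
  "transfers t t' \<Longrightarrow> {||} \<turnstile> tEq (spine t' us) (num n) \<Longrightarrow> {||} \<turnstile> tEq (spine t us) (num n)"
  unfolding transfers_def by (elim allE impE)

lemma transfers_App: "transfers t t' \<Longrightarrow> transfers (t \<cdot> u) (t' \<cdot> u)"
  using transfersD[of t t' "u # us" for us] unfolding transfers_def foldl_Cons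
  by (intro allI impI)

lemma transfers_head_step: "t \<triangleright> t' \<Longrightarrow> transfers t t'"
  unfolding transfers_def by (intro allI impI) (rule derivable_conv_trans[OF head_step_spine])

lemma transfers_argument: "{||} \<turnstile> tEq m m' \<Longrightarrow> transfers (t \<cdot> m') (t \<cdot> m)"
  unfolding transfers_def by (intro allI impI) (rule derivable_eq_argument)

lemma transfers_value: "transfers t t' \<Longrightarrow> {||} \<turnstile> tEq t' (num n) \<Longrightarrow> {||} \<turnstile> tEq t (num n)"
  using transfersD[of t t' "[]"] by (simp only: foldl_Nil)

lemma transfers_beta:
  "transfers t (tLam b) \<Longrightarrow> wft u \<Longrightarrow> transfers (t \<cdot> u) (inst b u)"
  by (rule transfers_trans[OF transfers_App transfers_head_step[OF step_beta]])

lemma transfers_rec_zero: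
  assumes "transfers t (tRec \<cdot> g \<cdot> h)" and "wft h" and "{||} \<turnstile> tEq m (num 0)"
  shows "transfers (t \<cdot> m) g"
proof -
  have "transfers (t \<cdot> m) (tRec \<cdot> g \<cdot> h \<cdot> m)" using assms(1) by (rule transfers_App)
  also have "transfers (tRec \<cdot> g \<cdot> h \<cdot> m) (tRec \<cdot> g \<cdot> h \<cdot> tZero)"
    using transfers_argument[OF derivable_eq_sym[OF assms(3)]] by simp
  also have "transfers (tRec \<cdot> g \<cdot> h \<cdot> tZero) g"
    using assms(2) by (rule transfers_head_step[OF step_rec_zero])
  finally show ?thesis .
qed

lemma transfers_rec_suc:
  assumes "transfers t (tRec \<cdot> g \<cdot> h)" and "wft g" and "{||} \<turnstile> tEq m (num (Suc k))"
  shows "transfers (t \<cdot> m) (h \<cdot> num k \<cdot> (tRec \<cdot> g \<cdot> h \<cdot> num k))"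
proof -
  have "transfers (t \<cdot> m) (tRec \<cdot> g \<cdot> h \<cdot> m)" using assms(1) by (rule transfers_App)
  also have "transfers (tRec \<cdot> g \<cdot> h \<cdot> m) (tRec \<cdot> g \<cdot> h \<cdot> tSuc (num k))"
    using transfers_argument[OF derivable_eq_sym[OF assms(3)]] by simp
  also have "transfers (tRec \<cdot> g \<cdot> h \<cdot> tSuc (num k)) (h \<cdot> num k \<cdot> (tRec \<cdot> g \<cdot> h \<cdot> num k))"
    using assms(2) by (rule transfers_head_step[OF step_rec_suc])
  finally show ?thesis .
qed

lemma derivable_true_num: "{||} \<turnstile> a \<Longrightarrow> {||} \<turnstile> tEq a (num tt)"
  using derivable_true_I[of "{||}" a] by simp

lemma derivable_false_num: "{||} \<turnstile> tNot a \<Longrightarrow> {||} \<turnstile> tEq a (num ff)"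
  by (rule derivable_false_I)

lemma derivable_num_true: "{||} \<turnstile> tEq a (num tt) \<Longrightarrow> {||} \<turnstile> a"
  using derivable_true_E[of "{||}" a] by simp

lemma derivable_num_false: "{||} \<turnstile> tEq a (num ff) \<Longrightarrow> {||} \<turnstile> tNot a"
  by (rule derivable_false_E)

text \<open>Each clause of the evaluation matches a rule. The conversion rule for the recursor applies only
  to literal numerals, so the recursion argument is first replaced by the numeral it equals.\<close>

theorem ev_derivable:
  "ev t n \<Longrightarrow> wft t \<Longrightarrow> {||} \<turnstile> tEq t (num n)"
  "evh t w \<Longrightarrow> wft t \<Longrightarrow> wft (head_trm w) \<and> transfers t (head_trm w)"
proof (induction rule: ev_evh.inducts)
  case e_zero
  show ?case using derivable_zero_nat by simp
next
  case (e_suc a n)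
  then have "{||} \<turnstile> tEq a (num n)" by simp
  then show ?case by (rule derivable_suc_num)
next
  case (e_eq a m b n)
  then have a: "{||} \<turnstile> tEq a (num m)" and b: "{||} \<turnstile> tEq b (num n)" by simp_all
  show ?case
  proof (cases "m = n")
    case True
    with a b have "{||} \<turnstile> tEq a b"
      using derivable_eq_trans[OF a derivable_eq_sym[of _ b]] by simp
    with True show ?thesis using derivable_true_num by simp
  next
    case False
    then show ?thesis using derivable_false_num[OF derivable_neq_num[OF a b]] by simp
  qed
next
  case (e_not_ff a)
  then have "{||} \<turnstile> tEq a (num ff)" by simp
  then show ?case by (rule derivable_true_num[OF derivable_num_false])
next
  case (e_not_tt a)
  then have "{||} \<turnstile> tEq a (num tt)" by simp
  then show ?case
    by (rule derivable_false_num[OF derivable_not_not_I[OF derivable_num_true]])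
next
  case (e_or_tt1 a b)
  then have "{||} \<turnstile> tEq a (num tt)" and "wft b" by simp_all
  then show ?case by (rule derivable_true_num[OF derivable_or_I1[OF derivable_num_true]])
next
  case (e_or_tt2 b a)
  then have "{||} \<turnstile> tEq b (num tt)" and "wft a" by simp_all
  then show ?case by (rule derivable_true_num[OF derivable_or_I2[OF derivable_num_true]])
next
  case (e_or_ff a b)
  then have "{||} \<turnstile> tEq a (num ff)" and "{||} \<turnstile> tEq b (num ff)" by simp_all
  then show ?case
    by (rule derivable_false_num[OF derivable_not_or_I[OF derivable_num_false derivable_num_false]])
next
  case (e_beta t b u r)
  then have "transfers t (tLam b)" "wft u" and "{||} \<turnstile> tEq (inst b u) (num r)"
    by (simp_all add: wft_inst)
  then show ?case by (rule transfers_value[OF transfers_beta])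
next
  case (e_rec_zero t g h m r)
  then have "transfers t (tRec \<cdot> g \<cdot> h)" "wft h" "{||} \<turnstile> tEq m (num ff)" "{||} \<turnstile> tEq g (num r)"
    by simp_all
  then show ?case by (rule transfers_value[OF transfers_rec_zero])
next
  case (e_rec_suc t g h m k r)
  then have "transfers t (tRec \<cdot> g \<cdot> h)" "wft g" "{||} \<turnstile> tEq m (num (Suc k))"
    "{||} \<turnstile> tEq (h \<cdot> num k \<cdot> (tRec \<cdot> g \<cdot> h \<cdot> num k)) (num r)"
    by simp_all
  then show ?case by (rule transfers_value[OF transfers_rec_suc])
next
  case (e_all_tt t u)
  then have "transfers (t \<cdot> u) (tAll \<cdot> u)" by (simp add: transfers_App)
  moreover have "{||} \<turnstile> tEq (tAll \<cdot> u) (num tt)"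
    using e_all_tt.hyps(2) by (intro derivable_true_num[OF derivable_all_I]) simp
  ultimately show ?case by (rule transfers_value)
next
  case (e_all_ff t u i)
  then have "transfers (t \<cdot> u) (tAll \<cdot> u)" by (simp add: transfers_App)
  moreover have "{||} \<turnstile> tEq (tAll \<cdot> u) (num ff)"
    using e_all_ff.hyps(2) by (rule derivable_false_num[OF derivable_not_all_I[OF _ derivable_num_nat]])
  ultimately show ?case by (rule transfers_value)
next
  case (eh_rec1 t g)
  then show ?case by (simp add: transfers_App)
next
  case (eh_rec2 t g h)
  then show ?case by (simp add: transfers_App)
next
  case (eh_beta t b u w)
  then have "transfers t (tLam b)" "wft u"
    and "wft (head_trm w)" "transfers (inst b u) (head_trm w)"
    by (simp_all add: wft_inst)
  then show ?case using transfers_trans[OF transfers_beta] by blast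
next
  case (eh_rec_zero t g h m w)
  then have "transfers t (tRec \<cdot> g \<cdot> h)" "wft h" "{||} \<turnstile> tEq m (num ff)"
    and "wft (head_trm w)" "transfers g (head_trm w)"
    by simp_all
  then show ?case using transfers_trans[OF transfers_rec_zero] by blast
next
  case (eh_rec_suc t g h m k w)
  then have "transfers t (tRec \<cdot> g \<cdot> h)" "wft g" "{||} \<turnstile> tEq m (num (Suc k))"
    and "wft (head_trm w)" "transfers (h \<cdot> num k \<cdot> (tRec \<cdot> g \<cdot> h \<cdot> num k)) (head_trm w)"
    by simp_all
  then show ?case using transfers_trans[OF transfers_rec_suc] by blast
qed (simp_all add: transfers_refl)

subsection \<open>Terms of equal value are interchangeable\<close>

lemma lift_closed: "closed s \<Longrightarrow> lift (Suc 0) (Var(v := s)) = Var(Suc v := s)"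
proof
  fix i assume "closed s"
  then show "lift (Suc 0) (Var(v := s)) i = (Var(Suc v := s)) i"
    using shift_closed[of s] by (cases i) (auto simp: lift_def shift_def)
qed

lemma sub1_Lam: "closed s \<Longrightarrow> sub1 v s (tLam b) = tLam (sub1 (Suc v) s b)"
  by (simp add: sub1_def lift_closed)

lemma sub1_inst: "closed s \<Longrightarrow> sub1 v s (inst b u) = inst (sub1 (Suc v) s b) (sub1 v s u)"
  by (simp add: sub1_def sub_inst lift_closed)

lemma sub1_shift: "closed s \<Longrightarrow> sub1 (Suc v) s (shift u) = shift (sub1 v s u)"
  unfolding sub1_def shift_def sub_ren ren_sub
  using shift_closed[of s] by (intro sub_cong) (auto simp: shift_def)

lemma sub1_eq_Op0:
  "sub1 v s p = Op f 0 ts \<longleftrightarrow>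
     p = Var v \<and> s = Op f 0 ts \<or> (\<exists>ps. p = Op f 0 ps \<and> map (sub1 v s) ps = ts)"
proof (cases p)
  case (Op g k ps)
  then show ?thesis by (cases k) (auto simp: sub1_def)
qed auto

lemma sub1_eq_Lam:
  "closed s \<Longrightarrow> sub1 v s p = tLam b \<longleftrightarrow>
     p = Var v \<and> s = tLam b \<or> (\<exists>q. p = tLam q \<and> sub1 (Suc v) s q = b)"
proof (cases p)
  case (Op g k ps)
  assume "closed s"
  with Op show ?thesis by (auto simp: sub1_def lift_closed)
qed auto

fun head_sub1 :: "nat \<Rightarrow> trm \<Rightarrow> head \<Rightarrow> head" where
  "head_sub1 v s (HLam b) = HLam (sub1 (Suc v) s b)"
| "head_sub1 v s HRec = HRec"
| "head_sub1 v s (HRec1 g) = HRec1 (sub1 v s g)"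
| "head_sub1 v s (HRec2 g h) = HRec2 (sub1 v s g) (sub1 v s h)"
| "head_sub1 v s HAll = HAll"

lemma head_sub1_eq [simp]:
  "head_sub1 v s w = HLam b \<longleftrightarrow> (\<exists>q. w = HLam q \<and> sub1 (Suc v) s q = b)"
  "head_sub1 v s w = HRec \<longleftrightarrow> w = HRec"
  "head_sub1 v s w = HRec1 g \<longleftrightarrow> (\<exists>q. w = HRec1 q \<and> sub1 v s q = g)"
  "head_sub1 v s w = HRec2 g h \<longleftrightarrow> (\<exists>q q'. w = HRec2 q q' \<and> sub1 v s q = g \<and> sub1 v s q' = h)"
  "head_sub1 v s w = HAll \<longleftrightarrow> w = HAll"
  by (cases w; auto)+

text \<open>By induction on the evaluation of \<open>p\<close> with \<open>x\<close> for \<open>v\<close>, for all templates \<open>p\<close> at once. If \<open>p\<close> is \<open>v\<close> itself,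
  determinism gives \<open>x\<close> and hence \<open>y\<close> the result in question; \<open>x\<close> cannot sit in head
  position, having a value. Otherwise \<open>p\<close> has the outermost operator of the instance and its arguments are again
  templates. In the quantifier clauses the required derivability carries over by \<open>eq_subst\<close>, because
  \<open>x = y\<close> is derivable by \<open>ev_derivable\<close>.\<close>

lemma ev_interchange_aux:
  assumes xy: "ev x k0" "ev y k0" and closed: "closed x" "closed y" and wf: "wft x" "wft y"
  shows "ev t r \<Longrightarrow> wft t \<Longrightarrow> sub1 v x p = t \<Longrightarrow> ev (sub1 v y p) r"
    and "evh t w \<Longrightarrow> wft t \<Longrightarrow> sub1 v x p = t \<Longrightarrow>
      \<exists>w0. head_sub1 v x w0 = w \<and> evh (sub1 v y p) (head_sub1 v y w0)"
proof -
  have "{||} \<turnstile> tEq x y"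
    using derivable_eq_trans[OF ev_derivable(1)[OF xy(1) wf(1)]
        derivable_eq_sym[OF ev_derivable(1)[OF xy(2) wf(2)]]] .
  then have eq: "\<Gamma> \<turnstile> tEq x y" for \<Gamma>
    by (rule derivable_weaken_all)
  \<comment> \<open>The variable is arbitrary since \<open>v\<close> becomes \<open>Suc v\<close> in the generic instance of a quantifier.\<close>
  have rewrite: "\<Gamma> \<turnstile> sub1 z y q" if "\<Gamma> \<turnstile> sub1 z x q" for \<Gamma> z q
  proof (rule derivable_eq_subst[OF eq that])
    from derivable_wft[OF that] show "wft q" unfolding sub1_def by (rule wft_of_sub)
  qed
  have evI: "ev (sub1 v y p) r"
    if "ev t r" and "sub1 v x p = t" and "p \<noteq> Var v \<Longrightarrow> ev (sub1 v y p) r" for p t r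
  proof (cases "p = Var v")
    case True
    with that(1,2) have "ev x r" by simp
    then have "r = k0" by (rule ev_unique[OF _ xy(1)])
    with True xy(2) show ?thesis by simp
  qed (rule that(3))
  have Op0: "\<exists>ps. p = Op f 0 ps \<and> map (sub1 v x) ps = ts"
    if "sub1 v x p = Op f 0 ts" and "p \<noteq> Var v" for p f ts
    using that by (simp add: sub1_eq_Op0)
  have evh_Op0: "\<exists>ps. p = Op f 0 ps \<and> map (sub1 v x) ps = ts"
    if "evh (Op f 0 ts) w" and "sub1 v x p = Op f 0 ts" for p f ts w
    using that ev_not_evh[OF xy(1)] by (auto simp: sub1_eq_Op0)
  show "ev t r \<Longrightarrow> wft t \<Longrightarrow> sub1 v x p = t \<Longrightarrow> ev (sub1 v y p) r"
    and "evh t w \<Longrightarrow> wft t \<Longrightarrow> sub1 v x p = t \<Longrightarrow>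
      \<exists>w0. head_sub1 v x w0 = w \<and> evh (sub1 v y p) (head_sub1 v y w0)"
  proof (induction arbitrary: p and p rule: ev_evh.inducts)
    case e_zero
    show ?case
    proof (rule evI[OF ev_evh.e_zero e_zero(2)])
      assume "p \<noteq> Var v"
      from Op0[OF e_zero(2) this] show "ev (sub1 v y p) 0" by auto
    qed
  next
    case (e_suc a n)
    show ?case
    proof (rule evI[OF ev_evh.e_suc[OF e_suc.hyps(1)] e_suc.prems(2)])
      assume "p \<noteq> Var v"
      from Op0[OF e_suc.prems(2) this] show "ev (sub1 v y p) (Suc n)"
        using e_suc by auto
    qed
  next
    case (e_eq a m b n)
    show ?case
    proof (rule evI[OF ev_evh.e_eq[OF e_eq.hyps] e_eq.prems(2)])
      assume "p \<noteq> Var v"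
      from Op0[OF e_eq.prems(2) this] obtain q q' where
        "p = tEq q q'" "sub1 v x q = a" "sub1 v x q' = b" by auto
      then show "ev (sub1 v y p) (if m = n then tt else ff)"
        using e_eq by (simp only: sub1_Op0 list.map) (intro ev_evh.e_eq; simp)
    qed
  next
    case (e_not_ff a)
    show ?case
    proof (rule evI[OF ev_evh.e_not_ff[OF e_not_ff.hyps(1)] e_not_ff.prems(2)])
      assume "p \<noteq> Var v"
      from Op0[OF e_not_ff.prems(2) this] show "ev (sub1 v y p) tt"
        using e_not_ff by (auto intro: ev_evh.e_not_ff)
    qed
  next
    case (e_not_tt a)
    show ?case
    proof (rule evI[OF ev_evh.e_not_tt[OF e_not_tt.hyps(1)] e_not_tt.prems(2)])
      assume "p \<noteq> Var v"
      from Op0[OF e_not_tt.prems(2) this] show "ev (sub1 v y p) ff"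
        using e_not_tt by (auto intro: ev_evh.e_not_tt)
    qed
  next
    case (e_or_tt1 a b)
    show ?case
    proof (rule evI[OF ev_evh.e_or_tt1[OF e_or_tt1.hyps(1)] e_or_tt1.prems(2)])
      assume "p \<noteq> Var v"
      from Op0[OF e_or_tt1.prems(2) this] show "ev (sub1 v y p) tt"
        using e_or_tt1 by (auto intro: ev_evh.e_or_tt1)
    qed
  next
    case (e_or_tt2 b a)
    show ?case
    proof (rule evI[OF ev_evh.e_or_tt2[OF e_or_tt2.hyps(1)] e_or_tt2.prems(2)])
      assume "p \<noteq> Var v"
      from Op0[OF e_or_tt2.prems(2) this] show "ev (sub1 v y p) tt"
        using e_or_tt2 by (auto intro: ev_evh.e_or_tt2)
    qed
  next
    case (e_or_ff a b)
    show ?case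
    proof (rule evI[OF ev_evh.e_or_ff[OF e_or_ff.hyps] e_or_ff.prems(2)])
      assume "p \<noteq> Var v"
      from Op0[OF e_or_ff.prems(2) this] show "ev (sub1 v y p) ff"
        using e_or_ff by (auto intro: ev_evh.e_or_ff)
    qed
  next
    case (e_beta t b u r)
    have "wft (inst b u)"
      using ev_derivable(2)[OF e_beta.hyps(1)] e_beta.prems(1) by (simp add: wft_inst)
    note IH = e_beta.IH(1) e_beta.IH(2)[OF this]
    show ?case
    proof (rule evI[OF ev_evh.e_beta[OF e_beta.hyps] e_beta.prems(2)])
      assume "p \<noteq> Var v"
      from Op0[OF e_beta.prems(2) this] obtain q q' where
        p: "p = q \<cdot> q'" "sub1 v x q = t" "sub1 v x q' = u" by auto
      obtain c where c: "sub1 (Suc v) x c = b" "evh (sub1 v y q) (HLam (sub1 (Suc v) y c))"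
        using IH(1)[OF _ p(2)] e_beta.prems(1) by auto
      have "ev (sub1 v y (inst c q')) r"
        using c(1) p(3) closed by (intro IH(2)) (simp add: sub1_inst)
      then show "ev (sub1 v y p) r"
        using ev_evh.e_beta[OF c(2)] closed by (simp add: p sub1_inst)
    qed
  next
    case (e_rec_zero t g h m r)
    have wf: "wft t" "wft m" "wft g"
      using ev_derivable(2)[OF e_rec_zero.hyps(1)] e_rec_zero.prems(1) by simp_all
    show ?case
    proof (rule evI[OF ev_evh.e_rec_zero[OF e_rec_zero.hyps] e_rec_zero.prems(2)])
      assume "p \<noteq> Var v"
      from Op0[OF e_rec_zero.prems(2) this] obtain q q' where
        p: "p = q \<cdot> q'" "sub1 v x q = t" "sub1 v x q' = m" by auto
      obtain g' h' where gh: "sub1 v x g' = g"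
        "evh (sub1 v y q) (HRec2 (sub1 v y g') (sub1 v y h'))"
        using e_rec_zero.IH(1)[OF wf(1) p(2)] by auto
      show "ev (sub1 v y p) r"
        using ev_evh.e_rec_zero[OF gh(2) e_rec_zero.IH(2)[OF wf(2) p(3)] e_rec_zero.IH(3)[OF wf(3) gh(1)]]
        by (simp add: p)
    qed
  next
    case (e_rec_suc t g h m k r)
    have wf: "wft t" "wft m" "wft (h \<cdot> num k \<cdot> (tRec \<cdot> g \<cdot> h \<cdot> num k))"
      using ev_derivable(2)[OF e_rec_suc.hyps(1)] e_rec_suc.prems(1) by simp_all
    show ?case
    proof (rule evI[OF ev_evh.e_rec_suc[OF e_rec_suc.hyps] e_rec_suc.prems(2)])
      assume "p \<noteq> Var v"
      from Op0[OF e_rec_suc.prems(2) this] obtain q q' where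
        p: "p = q \<cdot> q'" "sub1 v x q = t" "sub1 v x q' = m" by auto
      obtain g' h' where gh: "sub1 v x g' = g" "sub1 v x h' = h"
        "evh (sub1 v y q) (HRec2 (sub1 v y g') (sub1 v y h'))"
        using e_rec_suc.IH(1)[OF wf(1) p(2)] by auto
      have "ev (sub1 v y (h' \<cdot> num k \<cdot> (tRec \<cdot> g' \<cdot> h' \<cdot> num k))) r"
        by (rule e_rec_suc.IH(3)[OF wf(3)]) (simp add: gh)
      then show "ev (sub1 v y p) r"
        using ev_evh.e_rec_suc[OF gh(3) e_rec_suc.IH(2)[OF wf(2) p(3)]] by (simp add: p)
    qed
  next
    case (e_all_tt t u)
    have wf: "wft t" "wft u" using e_all_tt.prems(1) by simp_all
    show ?case
    proof (rule evI[OF ev_evh.e_all_tt[OF e_all_tt.hyps] e_all_tt.prems(2)])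
      assume "p \<noteq> Var v"
      from Op0[OF e_all_tt.prems(2) this] obtain q q' where
        p: "p = q \<cdot> q'" "sub1 v x q = t" "sub1 v x q' = u" by auto
      have "evh (sub1 v y q) HAll" using e_all_tt.IH(1)[OF wf(1) p(2)] by auto
      moreover have "{|tNat (Var 0)|} \<turnstile> shift (sub1 v y q') \<cdot> Var 0"
        using rewrite[of _ "Suc v" "shift q' \<cdot> Var 0"] e_all_tt.hyps(2) closed
        by (simp add: sub1_shift p(3))
      moreover have "ev (sub1 v y q' \<cdot> num n) tt" for n
        using e_all_tt.IH(2)[of n "q' \<cdot> num n"] wf(2) p(3) by simp
      ultimately have "ev (sub1 v y q \<cdot> sub1 v y q') tt" by (rule ev_evh.e_all_tt)
      then show "ev (sub1 v y p) tt" by (simp add: p)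
    qed
  next
    case (e_all_ff t u i)
    have wf: "wft t" "wft u" using e_all_ff.prems(1) by simp_all
    show ?case
    proof (rule evI[OF ev_evh.e_all_ff[OF e_all_ff.hyps] e_all_ff.prems(2)])
      assume "p \<noteq> Var v"
      from Op0[OF e_all_ff.prems(2) this] obtain q q' where
        p: "p = q \<cdot> q'" "sub1 v x q = t" "sub1 v x q' = u" by auto
      have "evh (sub1 v y q) HAll" using e_all_ff.IH(1)[OF wf(1) p(2)] by auto
      moreover have "{||} \<turnstile> tNot (sub1 v y q' \<cdot> num i)"
        using rewrite[of _ v "tNot (q' \<cdot> num i)"] e_all_ff.hyps(2) by (simp add: p(3))
      moreover have "ev (sub1 v y q' \<cdot> num i) ff"
        using e_all_ff.IH(2)[of "q' \<cdot> num i"] wf(2) p(3) by simp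
      ultimately have "ev (sub1 v y q \<cdot> sub1 v y q') ff" by (rule ev_evh.e_all_ff)
      then show "ev (sub1 v y p) ff" by (simp add: p)
    qed
  next
    case (eh_lam b)
    have "x \<noteq> tLam b" using ev_not_evh[OF xy(1), of "HLam b"] by auto
    with eh_lam.prems(2) closed obtain q where "p = tLam q" "sub1 (Suc v) x q = b"
      by (auto simp: sub1_eq_Lam)
    with closed show ?case by (intro exI[of _ "HLam q"]) (simp add: sub1_Lam)
  next
    case eh_rec
    from evh_Op0[OF ev_evh.eh_rec eh_rec(2)] show ?case by auto
  next
    case eh_all
    from evh_Op0[OF ev_evh.eh_all eh_all(2)] show ?case by auto
  next
    case (eh_rec1 t g)
    from evh_Op0[OF ev_evh.eh_rec1[OF eh_rec1.hyps] eh_rec1.prems(2)] obtain q q' where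
      p: "p = q \<cdot> q'" "sub1 v x q = t" "sub1 v x q' = g" by auto
    have "evh (sub1 v y q) HRec" using eh_rec1.IH[OF _ p(2)] eh_rec1.prems(1) by auto
    then have "evh (sub1 v y p) (HRec1 (sub1 v y q'))" using ev_evh.eh_rec1 by (simp add: p)
    with p(3) show ?case by (intro exI[of _ "HRec1 q'"]) simp
  next
    case (eh_rec2 t g h)
    from evh_Op0[OF ev_evh.eh_rec2[OF eh_rec2.hyps] eh_rec2.prems(2)] obtain q q' where
      p: "p = q \<cdot> q'" "sub1 v x q = t" "sub1 v x q' = h" by auto
    obtain g' where g': "sub1 v x g' = g" "evh (sub1 v y q) (HRec1 (sub1 v y g'))"
      using eh_rec2.IH[OF _ p(2)] eh_rec2.prems(1) by auto
    then have "evh (sub1 v y p) (HRec2 (sub1 v y g') (sub1 v y q'))"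
      using ev_evh.eh_rec2 by (simp add: p)
    with p(3) g'(1) show ?case by (intro exI[of _ "HRec2 g' q'"]) simp
  next
    case (eh_beta t b u w)
    have "wft (inst b u)"
      using ev_derivable(2)[OF eh_beta.hyps(1)] eh_beta.prems(1) by (simp add: wft_inst)
    note IH = eh_beta.IH(1) eh_beta.IH(2)[OF this]
    from evh_Op0[OF ev_evh.eh_beta[OF eh_beta.hyps] eh_beta.prems(2)] obtain q q' where
      p: "p = q \<cdot> q'" "sub1 v x q = t" "sub1 v x q' = u" by auto
    obtain c where c: "sub1 (Suc v) x c = b" "evh (sub1 v y q) (HLam (sub1 (Suc v) y c))"
      using IH(1)[OF _ p(2)] eh_beta.prems(1) by auto
    have "sub1 v x (inst c q') = inst b u" using c(1) p(3) closed by (simp add: sub1_inst)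
    from IH(2)[OF this] obtain w0 where "head_sub1 v x w0 = w"
      "evh (inst (sub1 (Suc v) y c) (sub1 v y q')) (head_sub1 v y w0)"
      using closed by (auto simp: sub1_inst)
    then show ?case using ev_evh.eh_beta[OF c(2)] by (intro exI[of _ w0]) (simp add: p)
  next
    case (eh_rec_zero t g h m w)
    have wf: "wft t" "wft m" "wft g"
      using ev_derivable(2)[OF eh_rec_zero.hyps(1)] eh_rec_zero.prems(1) by simp_all
    from evh_Op0[OF ev_evh.eh_rec_zero[OF eh_rec_zero.hyps] eh_rec_zero.prems(2)]
    obtain q q' where p: "p = q \<cdot> q'" "sub1 v x q = t" "sub1 v x q' = m" by auto
    obtain g' h' where gh: "sub1 v x g' = g"
      "evh (sub1 v y q) (HRec2 (sub1 v y g') (sub1 v y h'))"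
      using eh_rec_zero.IH(1)[OF wf(1) p(2)] by auto
    obtain w0 where "head_sub1 v x w0 = w" "evh (sub1 v y g') (head_sub1 v y w0)"
      using eh_rec_zero.IH(3)[OF wf(3) gh(1)] by auto
    then show ?case
      using ev_evh.eh_rec_zero[OF gh(2) eh_rec_zero.IH(2)[OF wf(2) p(3)]]
      by (intro exI[of _ w0]) (simp add: p)
  next
    case (eh_rec_suc t g h m k w)
    have wf: "wft t" "wft m" "wft (h \<cdot> num k \<cdot> (tRec \<cdot> g \<cdot> h \<cdot> num k))"
      using ev_derivable(2)[OF eh_rec_suc.hyps(1)] eh_rec_suc.prems(1) by simp_all
    from evh_Op0[OF ev_evh.eh_rec_suc[OF eh_rec_suc.hyps] eh_rec_suc.prems(2)]
    obtain q q' where p: "p = q \<cdot> q'" "sub1 v x q = t" "sub1 v x q' = m" by auto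
    obtain g' h' where gh: "sub1 v x g' = g" "sub1 v x h' = h"
      "evh (sub1 v y q) (HRec2 (sub1 v y g') (sub1 v y h'))"
      using eh_rec_suc.IH(1)[OF wf(1) p(2)] by auto
    have "sub1 v x (h' \<cdot> num k \<cdot> (tRec \<cdot> g' \<cdot> h' \<cdot> num k)) = h \<cdot> num k \<cdot> (tRec \<cdot> g \<cdot> h \<cdot> num k)"
      by (simp add: gh)
    from eh_rec_suc.IH(3)[OF wf(3) this] obtain w0 where "head_sub1 v x w0 = w"
      "evh (sub1 v y h' \<cdot> num k \<cdot> (tRec \<cdot> sub1 v y g' \<cdot> sub1 v y h' \<cdot> num k)) (head_sub1 v y w0)"
      by auto
    then show ?case
      using ev_evh.eh_rec_suc[OF gh(3) eh_rec_suc.IH(2)[OF wf(2) p(3)]]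
      by (intro exI[of _ w0]) (simp add: p)
  qed
qed

lemma ev_interchange:
  assumes "ev x k" "ev y k" "closed x" "closed y" "wft x" "wft y" "wft p"
    and "ev (sub1 v x p) r"
  shows "ev (sub1 v y p) r"
  using ev_interchange_aux(1)[OF assms(1-6,8) wft_sub1 refl] assms(5,7) by blast

subsection \<open>Head steps\<close>

lemma evh_Rec2 [simp]: "evh (tRec \<cdot> g \<cdot> h) w \<longleftrightarrow> w = HRec2 g h"
proof -
  have "evh (tRec \<cdot> g) w \<longleftrightarrow> w = HRec1 g" for w
    by (simp add: evh_App[of tRec])
  then show ?thesis by (simp add: evh_App[of "tRec \<cdot> g"])
qed

lemma head_step_ev: "t \<triangleright> t' \<Longrightarrow> ev t = ev t' \<and> evh t = evh t'"
proof (induction rule: head_step.induct)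
  case (step_beta t b)
  show ?case by (intro conjI ext) (simp_all add: ev_App[of "tLam b"] evh_App[of "tLam b"])
next
  case (step_rec_zero h g)
  show ?case
    by (intro conjI ext) (simp_all add: ev_App[of "tRec \<cdot> g \<cdot> h"] evh_App[of "tRec \<cdot> g \<cdot> h"])
next
  case (step_rec_suc g h n)
  show ?case
    by (intro conjI ext) (simp_all add: ev_App[of "tRec \<cdot> g \<cdot> h"] evh_App[of "tRec \<cdot> g \<cdot> h"])
next
  case (step_app t t' u)
  then show ?case
    by (intro conjI ext) (simp_all only: ev_App[of t u] evh_App[of t u] ev_App[of t' u] evh_App[of t' u])
qed

lemma head_step_sub: "t \<triangleright> t' \<Longrightarrow> (\<And>i. wft (\<sigma> i)) \<Longrightarrow> sub \<sigma> t \<triangleright> sub \<sigma> t'"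
proof (induction rule: head_step.induct)
  case (step_beta t b)
  then show ?case by (simp add: sub_inst head_step.step_beta wft_sub)
next
  case (step_rec_zero h g)
  then show ?case by (simp add: head_step.step_rec_zero wft_sub)
next
  case (step_rec_suc g h n)
  then show ?case by (simp add: head_step.step_rec_suc wft_sub)
next
  case (step_app t t' u)
  then show ?case by (simp add: head_step.step_app)
qed

section \<open>Soundness for hereditary evaluation\<close>

lemma ev_Eq_tt: "ev (tEq a b) tt \<longleftrightarrow> (\<exists>n. ev a n \<and> ev b n)"
  by (auto simp: ev_Eq)

lemma ev_Eq_ff: "ev (tEq a b) ff \<longleftrightarrow> (\<exists>m n. m \<noteq> n \<and> ev a m \<and> ev b n)"
  by (auto simp: ev_Eq)

lemma ev_All: "ev (tAll \<cdot> f) r \<longleftrightarrow>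
    r = tt \<and> ({|tNat (Var 0)|} \<turnstile> shift f \<cdot> Var 0) \<and> (\<forall>n. ev (f \<cdot> num n) tt) \<or>
    r = ff \<and> (\<exists>i. ({||} \<turnstile> tNot (f \<cdot> num i)) \<and> ev (f \<cdot> num i) ff)"
  by (simp add: ev_App[of tAll])

definition grounding :: "(nat \<Rightarrow> trm) \<Rightarrow> bool" where
  "grounding \<sigma> \<longleftrightarrow> (\<forall>i. closed (\<sigma> i) \<and> wft (\<sigma> i))"

definition satisfies :: "(nat \<Rightarrow> trm) \<Rightarrow> trm fset \<Rightarrow> bool" where
  "satisfies \<sigma> \<Gamma> \<longleftrightarrow> grounding \<sigma> \<and> (\<forall>h. h |\<in>| \<Gamma> \<longrightarrow> ev (sub \<sigma> h) tt)"

lemma satisfies_finsert [simp]: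
  "satisfies \<sigma> (finsert a \<Gamma>) \<longleftrightarrow> ev (sub \<sigma> a) tt \<and> satisfies \<sigma> \<Gamma>"
  by (auto simp: satisfies_def)

lemma satisfies_grounding: "satisfies \<sigma> \<Gamma> \<Longrightarrow> grounding \<sigma>"
  by (simp add: satisfies_def)

lemma grounding_upd: "grounding \<sigma> \<Longrightarrow> closed s \<Longrightarrow> wft s \<Longrightarrow> grounding (\<sigma>(v := s))"
  by (simp add: grounding_def)

lemma grounding_case_nat: "grounding \<sigma> \<Longrightarrow> grounding (case_nat (num n) \<sigma>)"
  by (simp add: grounding_def split: nat.split)

lemma satisfies_shift: "satisfies \<sigma> \<Gamma> \<Longrightarrow> satisfies (case_nat (num n) \<sigma>) (shift |`| \<Gamma>)"
  by (auto simp: satisfies_def grounding_case_nat sub_shift)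

lemma sub1_sub_grounding:
  "grounding \<sigma> \<Longrightarrow> sub1 v s (sub (\<sigma>(v := Var v)) t) = sub (\<sigma>(v := s)) t"
  by (simp add: sub1_sub_closed grounding_def)

text \<open>The instance of \<open>ev_interchange\<close> that occurs in soundness: \<open>p\<close> may have other free variables than
  \<open>v\<close>, all of which \<open>\<sigma>\<close> closes.\<close>

lemma grounding_interchange:
  assumes \<sigma>: "grounding \<sigma>" and wf: "wft p" "wft a" "wft b"
    and ev: "ev (sub \<sigma> a) n" "ev (sub \<sigma> b) n" "ev (sub (\<sigma>(v := sub \<sigma> a)) p) r"
  shows "ev (sub (\<sigma>(v := sub \<sigma> b)) p) r"
proof -
  let ?p = "sub (\<sigma>(v := Var v)) p"
  have "wft ?p" "wft (sub \<sigma> a)" "wft (sub \<sigma> b)" "closed (sub \<sigma> a)" "closed (sub \<sigma> b)"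
    using \<sigma> wf by (auto simp: grounding_def intro!: wft_sub closed_sub)
  with ev ev_interchange[of "sub \<sigma> a" n "sub \<sigma> b" ?p v r] show ?thesis
    by (simp add: sub1_sub_grounding[OF \<sigma>])
qed

lemma ev_App_interchange:
  assumes "closed f" "wft f" "ev a n" "ev b n" "closed a" "closed b" "wft a" "wft b" "ev (f \<cdot> a) r"
  shows "ev (f \<cdot> b) r"
  using ev_interchange[of a n b "f \<cdot> Var 0" 0 r] assms by (simp add: sub1_closed)

text \<open>The derivability that \<open>e_all_tt\<close> demands. Substitute \<open>\<sigma>\<close> in the given derivation, shifted so that the
  generic variable \<open>v\<^sub>0\<close> is kept. The instances of \<open>\<Gamma>\<close> are closed and true, hence derivable
  by \<open>ev_derivable\<close>, and can be cut.\<close>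

lemma ground_generalization:
  assumes der: "finsert (tNat (Var 0)) (shift |`| \<Gamma>) \<turnstile> shift f \<cdot> Var 0"
    and sat: "satisfies \<sigma> \<Gamma>"
  shows "{|tNat (Var 0)|} \<turnstile> shift (sub \<sigma> f) \<cdot> Var 0"
proof -
  define \<tau> where "\<tau> = case_nat (Var 0) \<sigma>"
  have \<sigma>: "\<And>i. closed (\<sigma> i)" "\<And>i. wft (\<sigma> i)"
    using satisfies_grounding[OF sat] by (simp_all add: grounding_def)
  have shift: "sub \<tau> (shift t) = shift (sub \<sigma> t)" for t
    by (simp add: \<tau>_def sub_shift shift_closed closed_sub \<sigma>(1))
  have "sub \<tau> |`| ffilter wft (finsert (tNat (Var 0)) (shift |`| \<Gamma>)) \<turnstile> sub \<tau> (shift f \<cdot> Var 0)"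
    by (rule derivable_sub[OF derivable_from_wft[OF der]])
      (auto simp: \<tau>_def \<sigma> split: nat.split)
  also have "sub \<tau> (shift f \<cdot> Var 0) = shift (sub \<sigma> f) \<cdot> Var 0"
    by (simp add: shift) (simp add: \<tau>_def)
  also have "sub \<tau> |`| ffilter wft (finsert (tNat (Var 0)) (shift |`| \<Gamma>))
      = (sub \<sigma> |`| ffilter wft \<Gamma>) |\<union>| {|tNat (Var 0)|}"
  proof -
    have "sub \<tau> (tNat (Var 0)) = tNat (Var 0)" by (simp add: \<tau>_def)
    moreover have "sub \<tau> (shift t) = sub \<sigma> t" for t
      by (simp add: \<tau>_def sub_shift)
    then have "sub \<tau> |`| shift |`| ffilter wft \<Gamma> = sub \<sigma> |`| ffilter wft \<Gamma>"
      by (simp add: fset.map_comp comp_def)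
    ultimately show ?thesis
      by (simp add: ffilter_wft_finsert wft_shift_image)
  qed
  finally show ?thesis
  proof (rule derivable_cut_all)
    fix h assume "h |\<in>| sub \<sigma> |`| ffilter wft \<Gamma>"
    then obtain h' where h: "h = sub \<sigma> h'" "h' |\<in>| \<Gamma>" "wft h'" by auto
    then have "ev h tt" "wft h" using sat \<sigma> by (auto simp: satisfies_def intro: wft_sub)
    then have "{||} \<turnstile> tEq h (num tt)" by (rule ev_derivable(1))
    then show "{||} \<turnstile> h" by (rule derivable_num_true)
  qed
qed

text \<open>By induction on the derivation, with \<open>\<sigma>\<close> arbitrary: the substitution rule changes \<open>\<sigma>\<close> at one variable,
  the induction rule takes the values \<open>0, 1, 2, \<dots>\<close> for it in turn, and the
  quantifier rules shift \<open>\<sigma>\<close> and put a numeral for the generic variable.\<close>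

theorem derivable_sound: "\<Gamma> \<turnstile> c \<Longrightarrow> satisfies \<sigma> \<Gamma> \<Longrightarrow> ev (sub \<sigma> c) tt"
proof (induction arbitrary: \<sigma> rule: derivable_induct)
  case (infer \<Gamma> c)
  define E where "E = {(\<Gamma>, c). (\<Gamma> \<turnstile> c) \<and> (\<forall>\<sigma>. satisfies \<sigma> \<Gamma> \<longrightarrow> ev (sub \<sigma> c) tt)}"
  have der: "\<Delta> \<turnstile> d" if "(\<Delta>, d) \<in> E" for \<Delta> d
    using that by (simp add: E_def)
  have sound: "ev (sub \<sigma> d) tt" if "(\<Delta>, d) \<in> E" "satisfies \<sigma> \<Delta>" for \<Delta> d \<sigma>
    using that by (simp add: E_def)
  have wft: "wft d" if "(\<Delta>, d) \<in> E" for \<Delta> d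
    by (rule derivable_wft[OF der[OF that]])
  have "infer E (\<Gamma>, c)" using infer.IH unfolding E_def by simp
  then show "ev (sub \<sigma> c) tt" using infer.prems
  proof (induction "(\<Gamma>, c)" arbitrary: \<Gamma> c \<sigma> rule: infer.induct)
    case (hyp c \<Gamma>)
    then show ?case by simp
  next
    case (weaken \<Gamma> c a)
    then show ?case using sound by simp
  next
    case (cut \<Gamma> a c)
    then show ?case using sound[OF cut(1)] sound[OF cut(2)] by simp
  next
    case (subst \<Gamma> c s v)
    have \<sigma>: "grounding \<sigma>" using subst.prems by (rule satisfies_grounding)
    then have "closed (sub \<sigma> s)" "wft (sub \<sigma> s)"
      using \<open>wft s\<close> by (auto simp: grounding_def intro!: wft_sub closed_sub)
    then have "grounding (\<sigma>(v := sub \<sigma> s))" using \<sigma> by (intro grounding_upd)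
    moreover have "ev (sub (\<sigma>(v := sub \<sigma> s)) h) tt" if "h |\<in>| \<Gamma>" for h
    proof -
      have "sub1 v s h |\<in>| sub1 v s |`| \<Gamma>" using that by (rule fimageI)
      with subst.prems have "ev (sub \<sigma> (sub1 v s h)) tt" unfolding satisfies_def by blast
      then show ?thesis by (simp only: sub_sub1)
    qed
    ultimately have "satisfies (\<sigma>(v := sub \<sigma> s)) \<Gamma>" by (simp add: satisfies_def)
    then show ?case using sound[OF subst.hyps(1)] by (simp add: sub_sub1)
  next
    case (true_I \<Gamma> a)
    then show ?case using sound[OF true_I(1)] by (simp add: ev_Eq_tt)
  next
    case (true_E \<Gamma> a)
    then show ?case using sound[OF true_E(1)] by (simp add: ev_Eq_tt)
  next
    case (false_I \<Gamma> a)
    then show ?case using sound[OF false_I(1)] by (simp add: ev_Eq_tt)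
  next
    case (false_E \<Gamma> a)
    then show ?case using sound[OF false_E(1)] by (simp add: ev_Eq_tt)
  next
    case (contradiction \<Gamma> a c)
    from sound[OF contradiction(1,4)] have "ev (sub \<sigma> a) ff" by simp
    with sound[OF contradiction(2,4)] show ?case using ev_unique by fastforce
  next
    case (not_not_I \<Gamma> a)
    then show ?case using sound[OF not_not_I(1)] by simp
  next
    case (not_not_E \<Gamma> a)
    then show ?case using sound[OF not_not_E(1)] by simp
  next
    case (or_I1 \<Gamma> a b)
    then show ?case using sound[OF or_I1(1)] by simp
  next
    case (or_I2 \<Gamma> b a)
    then show ?case using sound[OF or_I2(1)] by simp
  next
    case (not_or_I \<Gamma> a b)
    then show ?case using sound[OF not_or_I(1)] sound[OF not_or_I(2)] by simp
  next
    case (or_E \<Gamma> a b c)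
    then show ?case
      using sound[OF or_E(1)] sound[OF or_E(2)] sound[OF or_E(3)] by auto
  next
    case (not_or_E1 \<Gamma> a b)
    then show ?case using sound[OF not_or_E1(1)] by simp
  next
    case (not_or_E2 \<Gamma> a b)
    then show ?case using sound[OF not_or_E2(1)] by simp
  next
    case (nat_eq \<Gamma> a)
    then show ?case by (rule sound)
  next
    case (eq_sym \<Gamma> a b)
    then show ?case using sound[OF eq_sym(1)] by (auto simp: ev_Eq_tt)
  next
    case (eq_subst \<Gamma> a b v p)
    have \<sigma>: "grounding \<sigma>" using eq_subst.prems by (rule satisfies_grounding)
    obtain n where n: "ev (sub \<sigma> a) n" "ev (sub \<sigma> b) n"
      using sound[OF eq_subst(1) eq_subst.prems] by (auto simp: ev_Eq_tt)
    have p: "ev (sub (\<sigma>(v := sub \<sigma> a)) p) tt"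
      using sound[OF eq_subst(2) eq_subst.prems] by (simp only: sub_sub1)
    have "wft a" "wft b" using wft[OF eq_subst(1)] by simp_all
    from grounding_interchange[OF \<sigma> \<open>wft p\<close> this n p] show ?case by (simp only: sub_sub1)
  next
    case (neq_sym \<Gamma> a b)
    obtain m n where "m \<noteq> n" "ev (sub \<sigma> a) m" "ev (sub \<sigma> b) n"
      using sound[OF neq_sym] by (auto simp: ev_Eq_ff)
    then have "ev (tEq (sub \<sigma> b) (sub \<sigma> a)) ff" unfolding ev_Eq_ff by metis
    then show ?case by simp
  next
    case (eq_bool_I \<Gamma> a b)
    obtain m n where "ev (sub \<sigma> a) m" "ev (sub \<sigma> b) n"
      using sound[OF eq_bool_I(1,3)] sound[OF eq_bool_I(2,3)] by (auto simp: ev_Eq_tt)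
    then have "ev (tEq (sub \<sigma> a) (sub \<sigma> b)) tt \<or> ev (tEq (sub \<sigma> a) (sub \<sigma> b)) ff"
      unfolding ev_Eq_tt ev_Eq_ff by metis
    then show ?case by auto
  next
    case (eq_bool_E \<Gamma> a b)
    have "ev (tEq (sub \<sigma> a) (sub \<sigma> b)) tt \<or> ev (tEq (sub \<sigma> a) (sub \<sigma> b)) ff"
      using sound[OF eq_bool_E] by auto
    then have "ev (tNat (sub \<sigma> a)) tt" "ev (tNat (sub \<sigma> b)) tt"
      unfolding ev_Eq_tt ev_Eq_ff by blast+
    then have "ev (tAnd (tNat (sub \<sigma> a)) (tNat (sub \<sigma> b))) tt"
      by (intro ev_evh.e_not_ff ev_evh.e_or_ff ev_evh.e_not_tt)
    then show ?case by simp
  next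
    case (zero_nat \<Gamma>)
    show ?case by (simp add: ev_Eq_tt)
  next
    case (suc_nat_I \<Gamma> a)
    then show ?case using sound[OF suc_nat_I(1)] by (auto simp: ev_Eq_tt)
  next
    case (suc_nat_E \<Gamma> a)
    then show ?case using sound[OF suc_nat_E(1)] by (auto simp: ev_Eq_tt)
  next
    case (suc_neq_zero \<Gamma> a)
    obtain n where "ev (sub \<sigma> a) n"
      using sound[OF suc_neq_zero] by (auto simp: ev_Eq_tt)
    then show ?case by (auto simp: ev_Eq_ff)
  next
    case (suc_neq_I \<Gamma> a b)
    obtain m n where "m \<noteq> n" "ev (sub \<sigma> a) m" "ev (sub \<sigma> b) n"
      using sound[OF suc_neq_I] by (auto simp: ev_Eq_ff)
    then have "ev (tEq (tSuc (sub \<sigma> a)) (tSuc (sub \<sigma> b))) ff"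
      unfolding ev_Eq_ff by (metis ev_evh.e_suc nat.inject)
    then show ?case by simp
  next
    case (suc_neq_E \<Gamma> a b)
    obtain m n where "m \<noteq> n" "ev (sub \<sigma> a) m" "ev (sub \<sigma> b) n"
      using sound[OF suc_neq_E] by (auto simp: ev_Eq_ff)
    then have "ev (tEq (sub \<sigma> a) (sub \<sigma> b)) ff" unfolding ev_Eq_ff by metis
    then show ?case by simp
  next
    case (suc_inj \<Gamma> a b)
    then show ?case using sound[OF suc_inj(1)] by (auto simp: ev_Eq_tt)
  next
    case (bot_nat \<Gamma> p)
    then show ?case using sound[OF bot_nat(1,3)] by (simp add: ev_Eq_tt)
  next
    case (induction \<Gamma> i c a)
    have \<sigma>: "grounding \<sigma>" using induction.prems by (rule satisfies_grounding)
    obtain k where k: "ev (sub \<sigma> a) k"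
      using sound[OF induction(3) induction.prems] by (auto simp: ev_Eq_tt)
    have "ev (sub (\<sigma>(i := num n)) c) tt" for n
    proof (induction n)
      case 0
      have "sub \<sigma> tZero = num 0" by simp
      with sound[OF induction(1) induction.prems] show ?case by (simp only: sub_sub1)
    next
      case (Suc n)
      have "sub (\<sigma>(i := num n)) h = sub \<sigma> h" if "h |\<in>| \<Gamma>" for h
        using induction(5) that by (intro sub_cong) auto
      then have "satisfies (\<sigma>(i := num n)) \<Gamma>"
        using induction.prems by (simp add: satisfies_def grounding_upd)
      moreover have "ev (sub (\<sigma>(i := num n)) (tNat (Var i))) tt" by (simp add: ev_Eq_tt)
      ultimately have "satisfies (\<sigma>(i := num n)) (finsert (tNat (Var i)) (finsert c \<Gamma>))"
        unfolding satisfies_finsert using Suc by blast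
      from sound[OF induction(2) this]
      have "ev (sub (\<sigma>(i := sub (\<sigma>(i := num n)) (tSuc (Var i)))) c) tt"
        by (simp only: sub_sub1 fun_upd_upd)
      moreover have "sub (\<sigma>(i := num n)) (tSuc (Var i)) = num (Suc n)" by simp
      ultimately show ?case by (simp only:)
    qed
    then have c: "ev (sub (\<sigma>(i := sub \<sigma> (num k))) c) tt" by simp
    have "wft a" using wft[OF induction(3)] by simp
    moreover have "ev (sub \<sigma> (num k)) k" by simp
    ultimately show ?case
      using grounding_interchange[OF \<sigma> \<open>wft c\<close> wft_num _ _ k c] by (simp only: sub_sub1)
  next
    case (conv_I c c' \<Gamma>)
    have "sub \<sigma> c \<triangleright> sub \<sigma> c'"
      using head_step_sub[OF conv_I(1)] satisfies_grounding[OF conv_I(3)] by (simp add: grounding_def)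
    with sound[OF conv_I(2,3)] show ?case by (simp add: head_step_ev)
  next
    case (conv_E c c' \<Gamma>)
    have "sub \<sigma> c \<triangleright> sub \<sigma> c'"
      using head_step_sub[OF conv_E(1)] satisfies_grounding[OF conv_E(3)] by (simp add: grounding_def)
    from head_step_ev[OF this] sound[OF conv_E(2,3)] show ?case by simp
  next
    case (conv_eq c c' \<Gamma>)
    have "sub \<sigma> c \<triangleright> sub \<sigma> c'"
      using head_step_sub[OF conv_eq(1)] satisfies_grounding[OF conv_eq(3)] by (simp add: grounding_def)
    from head_step_ev[OF this] sound[OF conv_eq(2,3)] show ?case by (simp add: ev_Eq_tt)
  next
    case (rec \<Gamma> m h g)
    let ?g = "sub \<sigma> g" and ?h = "sub \<sigma> h" and ?m = "sub \<sigma> m"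
    have \<sigma>: "grounding \<sigma>" using rec.prems by (rule satisfies_grounding)
    obtain k where k: "ev ?m k"
      using sound[OF rec(1) rec.prems] by (auto simp: ev_Eq_tt)
    obtain r where r: "ev (?h \<cdot> ?m \<cdot> (tRec \<cdot> ?g \<cdot> ?h \<cdot> ?m)) r"
      using sound[OF rec(2) rec.prems] by (auto simp: ev_Eq_tt)
    have closed: "closed ?g" "closed ?h" "closed ?m"
      using \<sigma> by (auto simp: grounding_def intro!: closed_sub)
    have "wft m" "wft h" using wft[OF rec(2)] by simp_all
    then have wf: "wft ?g" "wft ?h" "wft ?m"
      using \<open>wft g\<close> \<sigma> by (auto simp: grounding_def intro!: wft_sub)
    have "ev (?h \<cdot> num k \<cdot> (tRec \<cdot> ?g \<cdot> ?h \<cdot> num k)) r"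
      using ev_interchange[of ?m k "num k" "?h \<cdot> Var 0 \<cdot> (tRec \<cdot> ?g \<cdot> ?h \<cdot> Var 0)" 0 r]
        k r closed wf by (simp add: sub1_closed)
    then have "ev (tRec \<cdot> ?g \<cdot> ?h \<cdot> tSuc ?m) r"
      using k by (intro ev_evh.e_rec_suc[of "tRec \<cdot> ?g \<cdot> ?h" ?g ?h "tSuc ?m" k r]) simp_all
    with r have "ev (tEq (tRec \<cdot> ?g \<cdot> ?h \<cdot> tSuc ?m) (?h \<cdot> ?m \<cdot> (tRec \<cdot> ?g \<cdot> ?h \<cdot> ?m))) tt"
      unfolding ev_Eq_tt by blast
    then show ?case by simp
  next
    case (all_I \<Gamma> f)
    have inst: "ev (sub \<sigma> f \<cdot> num n) tt" for n
    proof -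
      have "satisfies (case_nat (num n) \<sigma>) (finsert (tNat (Var 0)) (shift |`| \<Gamma>))"
        using all_I.prems by (simp add: satisfies_shift ev_Eq_tt)
      from sound[OF all_I.hyps this] show ?thesis by (simp add: sub_shift)
    qed
    have "ev (tAll \<cdot> sub \<sigma> f) tt"
      by (rule ev_evh.e_all_tt[OF ev_evh.eh_all _ inst])
        (rule ground_generalization[OF der[OF all_I.hyps] all_I.prems])
    then show ?case by simp
  next
    case (all_E \<Gamma> f a)
    have \<sigma>: "grounding \<sigma>" using all_E.prems by (rule satisfies_grounding)
    obtain n where n: "ev (sub \<sigma> a) n"
      using sound[OF all_E(2) all_E.prems] by (auto simp: ev_Eq_tt)
    have f: "ev (sub \<sigma> f \<cdot> num n) tt"
      using sound[OF all_E(1) all_E.prems] by (simp add: ev_All)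
    have "wft (sub \<sigma> f)" "wft (sub \<sigma> a)" "closed (sub \<sigma> f)" "closed (sub \<sigma> a)"
      using \<sigma> wft[OF all_E(1)] wft[OF all_E(2)]
      by (auto simp: grounding_def intro!: wft_sub closed_sub)
    with n f have "ev (sub \<sigma> f \<cdot> sub \<sigma> a) tt"
      using ev_App_interchange[of "sub \<sigma> f" "num n" n "sub \<sigma> a" tt] by simp
    then show ?case by simp
  next
    case (not_all_I \<Gamma> f a)
    have \<sigma>: "grounding \<sigma>" using not_all_I.prems by (rule satisfies_grounding)
    obtain n where n: "ev (sub \<sigma> a) n"
      using sound[OF not_all_I(2) not_all_I.prems] by (auto simp: ev_Eq_tt)
    have f: "ev (sub \<sigma> f \<cdot> sub \<sigma> a) ff"
      using sound[OF not_all_I(1) not_all_I.prems] by simp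
    have wf: "wft (sub \<sigma> f)" "wft (sub \<sigma> a)" and "closed (sub \<sigma> f)" "closed (sub \<sigma> a)"
      using \<sigma> wft[OF not_all_I(1)]
      by (auto simp: grounding_def intro!: wft_sub closed_sub)
    with n f have ff: "ev (sub \<sigma> f \<cdot> num n) ff"
      using ev_App_interchange[of "sub \<sigma> f" "sub \<sigma> a" n "num n" ff] by simp
    have "wft (sub \<sigma> f \<cdot> num n)" using wf by simp
    from derivable_num_false[OF ev_derivable(1)[OF ff this]] have "ev (tAll \<cdot> sub \<sigma> f) ff"
      by (rule ev_evh.e_all_ff[OF ev_evh.eh_all _ ff])
    then show ?case by simp
  next
    case (not_all_E \<Gamma> f c)
    have "ev (tAll \<cdot> sub \<sigma> f) ff"
      using sound[OF not_all_E(1) not_all_E.prems] by simp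
    then obtain i where "ev (sub \<sigma> f \<cdot> num i) ff" by (auto simp: ev_All)
    then have "satisfies (case_nat (num i) \<sigma>)
        (finsert (tNat (Var 0)) (finsert (tNot (shift f \<cdot> Var 0)) (shift |`| \<Gamma>)))"
      using not_all_E.prems by (simp add: satisfies_shift ev_Eq_tt sub_shift)
    from sound[OF not_all_E(2) this] show ?case by (simp add: sub_shift)
  qed
qed

section \<open>Comparison with staged evaluation\<close>

text \<open>A witnessing proof in a staged evaluation is a derivation, so \<open>derivable_sound\<close> supplies the
  numeral instances that \<open>ev\<close> demands. The terms have to be closed for these instances not to depend
  on a substitution; closing the variables by \<open>tZero\<close> is an arbitrary choice.\<close>

lemma veval_ev:
  "t \<Down>\<^bsub>s\<^esub> r \<Longrightarrow> closed t \<Longrightarrow> ev t r"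
  "t \<Down>\<^sup>h\<^bsub>s\<^esub> w \<Longrightarrow> closed t \<Longrightarrow> evh t w \<and> closed (head_trm w)"
proof (induction rule: veval_heval.inducts)
  case (v_zero s)
  show ?case by (rule ev_evh.intros)
next
  case (v_suc a s n)
  then show ?case by (intro ev_evh.e_suc) simp
next
  case (v_eq a s m b n)
  then show ?case by (intro ev_evh.e_eq) simp_all
next
  case (v_not_ff a s)
  then show ?case by (intro ev_evh.e_not_ff) simp
next
  case (v_not_tt a s)
  then show ?case by (intro ev_evh.e_not_tt) simp
next
  case (v_or_tt1 a s b)
  then show ?case by (intro ev_evh.e_or_tt1) simp
next
  case (v_or_tt2 b s a)
  then show ?case by (intro ev_evh.e_or_tt2) simp
next
  case (v_or_ff a s b)
  then show ?case by (intro ev_evh.e_or_ff) simp_all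
next
  case (v_beta t s b u r)
  then have "evh t (HLam b)" "closed (inst b u)" by (simp_all add: closed_inst)
  with v_beta.IH(2) show ?case by (intro ev_evh.e_beta)
next
  case (v_rec_zero t s g h m r)
  then show ?case by (intro ev_evh.e_rec_zero[of t g h]) simp_all
next
  case (v_rec_suc t s g h m k r)
  then show ?case by (intro ev_evh.e_rec_suc[of t g h m k r]) simp_all
next
  case (v_all_tt t s P u)
  have der: "{|tNat (Var 0)|} \<turnstile> shift u \<cdot> Var 0"
    using v_all_tt.hyps(3) by (auto simp: derivable_def)
  have inst: "ev (u \<cdot> num n) tt" for n
  proof -
    have "satisfies (case_nat (num n) (\<lambda>_. tZero)) {|tNat (Var 0)|}"
      by (auto simp: satisfies_def grounding_def ev_Eq_tt split: nat.split)
    from derivable_sound[OF der this] show ?thesis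
      using v_all_tt.prems by (simp add: sub_shift sub_closed)
  qed
  have "evh t HAll" using v_all_tt by simp
  from this der inst show ?case by (rule ev_evh.e_all_tt)
next
  case (v_all_ff t s P u i)
  have der: "{||} \<turnstile> tNot (u \<cdot> num i)"
    using v_all_ff.hyps(3) by (auto simp: derivable_def)
  have "satisfies (\<lambda>_. tZero) {||}" by (simp add: satisfies_def grounding_def)
  from derivable_sound[OF der this] have inst: "ev (u \<cdot> num i) ff"
    using v_all_ff.prems by (simp add: sub_closed)
  have "evh t HAll" using v_all_ff by simp
  from this der inst show ?case by (rule ev_evh.e_all_ff)
next
  case (h_lam b s)
  then show ?case by simp
next
  case (h_rec s)
  show ?case by simp
next
  case (h_all s)
  show ?case by simp
next
  case (h_rec1 t s g)
  then show ?case by (simp add: ev_evh.eh_rec1)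
next
  case (h_rec2 t s g h)
  then show ?case by (simp add: ev_evh.eh_rec2)
next
  case (h_beta t s b u w)
  then have "evh t (HLam b)" "closed (inst b u)" by (simp_all add: closed_inst)
  with h_beta.IH(2) show ?case using ev_evh.eh_beta by blast
next
  case (h_rec_zero t s g h m w)
  then have "evh t (HRec2 g h)" "ev m 0" "evh g w" "closed (head_trm w)" by simp_all
  then show ?case using ev_evh.eh_rec_zero by blast
next
  case (h_rec_suc t s g h m k w)
  then have "evh t (HRec2 g h)" "ev m (Suc k)"
    "evh (h \<cdot> num k \<cdot> (tRec \<cdot> g \<cdot> h \<cdot> num k)) w" "closed (head_trm w)"
    by simp_all
  then show ?case using ev_evh.eh_rec_suc by blast
qed

lemma MOST_by_Suc: "(\<forall>\<^sub>\<infinity>s. P s) \<Longrightarrow> (\<And>s. P s \<Longrightarrow> Q (Suc s)) \<Longrightarrow> \<forall>\<^sub>\<infinity>s. Q s"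
  using MOST_mono[of P "\<lambda>s. Q (Suc s)"] MOST_Suc_iff[of Q] by blast

text \<open>Stating the result for all but finitely many stages combines several premises without a separate
  monotonicity argument, and absorbs the bound on the code of a witnessing proof.\<close>

lemma ev_veval:
  "ev t r \<Longrightarrow> \<forall>\<^sub>\<infinity>s. t \<Down>\<^bsub>s\<^esub> r"
  "evh t w \<Longrightarrow> \<forall>\<^sub>\<infinity>s. t \<Down>\<^sup>h\<^bsub>s\<^esub> w"
proof (induction rule: ev_evh.inducts)
  case e_zero
  show ?case by (rule MOST_by_Suc[OF MOST_I]) (rule TrueI, rule v_zero)
next
  case (e_suc a n)
  from e_suc.IH show ?case by (rule MOST_by_Suc) (rule v_suc)
next
  case (e_eq a m b n)
  from MOST_conjI[OF e_eq.IH] show ?case by (rule MOST_by_Suc) (blast intro: v_eq)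
next
  case (e_not_ff a)
  from e_not_ff.IH show ?case by (rule MOST_by_Suc) (rule v_not_ff)
next
  case (e_not_tt a)
  from e_not_tt.IH show ?case by (rule MOST_by_Suc) (rule v_not_tt)
next
  case (e_or_tt1 a b)
  from e_or_tt1.IH show ?case by (rule MOST_by_Suc) (rule v_or_tt1)
next
  case (e_or_tt2 b a)
  from e_or_tt2.IH show ?case by (rule MOST_by_Suc) (rule v_or_tt2)
next
  case (e_or_ff a b)
  from MOST_conjI[OF e_or_ff.IH] show ?case by (rule MOST_by_Suc) (blast intro: v_or_ff)
next
  case (e_beta t b u r)
  from MOST_conjI[OF e_beta.IH] show ?case by (rule MOST_by_Suc) (blast intro: v_beta)
next
  case (e_rec_zero t g h m r)
  from MOST_conjI[OF MOST_conjI[OF e_rec_zero.IH(1,2)] e_rec_zero.IH(3)]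
  show ?case by (rule MOST_by_Suc) (blast intro: v_rec_zero)
next
  case (e_rec_suc t g h m k r)
  from MOST_conjI[OF MOST_conjI[OF e_rec_suc.IH(1,2)] e_rec_suc.IH(3)]
  show ?case by (rule MOST_by_Suc) (blast intro: v_rec_suc)
next
  case (e_all_tt t u)
  from e_all_tt.hyps(2) obtain P where "proves P ({|tNat (Var 0)|}, shift u \<cdot> Var 0)"
    unfolding derivable_def ..
  with MOST_conjI[OF e_all_tt.IH(1) MOST_ge_nat[of "proof_code P"]]
  show ?case by (elim MOST_by_Suc) (blast intro: v_all_tt)
next
  case (e_all_ff t u i)
  from e_all_ff.hyps(2) obtain P where "proves P ({||}, tNot (u \<cdot> num i))"
    unfolding derivable_def ..
  with MOST_conjI[OF e_all_ff.IH(1) MOST_ge_nat[of "proof_code P"]]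
  show ?case by (elim MOST_by_Suc) (blast intro: v_all_ff)
next
  case (eh_lam b)
  show ?case by (rule MOST_by_Suc[OF MOST_I]) (rule TrueI, rule h_lam)
next
  case eh_rec
  show ?case by (rule MOST_by_Suc[OF MOST_I]) (rule TrueI, rule h_rec)
next
  case eh_all
  show ?case by (rule MOST_by_Suc[OF MOST_I]) (rule TrueI, rule h_all)
next
  case (eh_rec1 t g)
  from eh_rec1.IH show ?case by (rule MOST_by_Suc) (rule h_rec1)
next
  case (eh_rec2 t g h)
  from eh_rec2.IH show ?case by (rule MOST_by_Suc) (rule h_rec2)
next
  case (eh_beta t b u w)
  from MOST_conjI[OF eh_beta.IH] show ?case by (rule MOST_by_Suc) (blast intro: h_beta)
next
  case (eh_rec_zero t g h m w)
  from MOST_conjI[OF MOST_conjI[OF eh_rec_zero.IH(1,2)] eh_rec_zero.IH(3)]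
  show ?case by (rule MOST_by_Suc) (blast intro: h_rec_zero)
next
  case (eh_rec_suc t g h m k w)
  from MOST_conjI[OF MOST_conjI[OF eh_rec_suc.IH(1,2)] eh_rec_suc.IH(3)]
  show ?case by (rule MOST_by_Suc) (blast intro: h_rec_suc)
qed

lemma closed_veval_iff: "closed t \<Longrightarrow> (\<exists>s. t \<Down>\<^bsub>s\<^esub> r) \<longleftrightarrow> ev t r"
  using veval_ev(1) INFM_EX[OF MOST_INFM[OF infinite_UNIV_nat ev_veval(1)]] by blast

definition assigned :: "assignment \<Rightarrow> nat \<Rightarrow> trm" where
  "assigned A = (\<lambda>i. case A i of Some n \<Rightarrow> num n | None \<Rightarrow> tBot)"

lemma grounding_assigned: "grounding (assigned A)"
  by (simp add: grounding_def assigned_def split: option.split)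

lemma grounded_true_iff: "grounded_true A t \<longleftrightarrow> ev (sub (assigned A) t) tt"
proof -
  have "closed (sub (assigned A) t)"
    using grounding_assigned by (intro closed_sub) (simp add: grounding_def)
  moreover have "closure A t = sub (assigned A) t"
    by (simp add: closure_def assigned_def)
  ultimately show ?thesis
    by (simp add: grounded_true_def closed_veval_iff)
qed

theorem theorem4p2:
  fixes \<Gamma> :: "trm fset" and c :: trm
  assumes "\<Gamma> \<turnstile> c"
  shows "\<forall>A :: assignment. (\<forall>h. h |\<in>| \<Gamma> \<longrightarrow> grounded_true A h) \<longrightarrow> grounded_true A c"
proof (intro allI impI)
  fix A assume "\<forall>h. h |\<in>| \<Gamma> \<longrightarrow> grounded_true A h"
  then have "satisfies (assigned A) \<Gamma>"
    by (simp add: satisfies_def grounding_assigned grounded_true_iff)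
  with assms show "grounded_true A c"
    by (simp add: grounded_true_iff derivable_sound)
qed

end
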